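(* Let $F$ be an ultra-finite field. Let $\alpha$ be a polynomial in $F[t]$ of positive degree, and let $n$ be a positive integer such that either $F$ has characteristic $0$ or the characteristic of $F$ does not divide $n$. Then $x^n=\alpha$ is solvable in $F[t]$ if and only if $x^n=\alpha$ is solvable in the $P$-adic field $F(t)_P$ for all but finitely many monic primes $P$ of $F[t]$.
   Context: Fix an infinite set $S$ and a nonprincipal ultrafilter $\mathcal{D}$ on $S$. An ultra-finite field is an ultraproduct $F=\prod_{s\in S}\mathbb{F}_{q_s}/\mathcal{D}$, where $\mathbb{F}_{q_s}$ is the finite field with $q_s$ elements ($q_s$ a prime power) for $\mathcal{D}$-almost all $s$, i.e. for all $s$ in some set belonging to $\mathcal{D}$. A monic prime of $F[t]$ is a monic irreducible polynomial. For a monic prime $P$, the $P$-adic valuation $v_P$ on $F(t)$ is given by $v_P(0)=\infty$ and $v_P(P^k f/g)=k$ for $k\in\mathbb{Z}$ and nonzero $f,g\in F[t]$ not divisible by $P$; $F(t)_P$ is the completion of $F(t)$ with respect to $v_P$. *)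

theory Defs
  imports "HOL-Algebra.Algebraic_Closure_Type" "HOL-Algebra.QuotRing" "HOL-Library.Extended"
begin

section \<open>Ultraproducts of rings\<close>

text \<open>The index set is the type \<open>'s\<close>; the ultrafilter is given as a filter, so that
  \<open>\<forall>\<^sub>F s in D. Q s\<close> reads ``for \<open>D\<close>-almost all \<open>s\<close>''.\<close>

definition ultrafilter :: "'s filter \<Rightarrow> bool" where
  "ultrafilter D \<longleftrightarrow>
     D \<noteq> bot \<and> (\<forall>Q. (\<forall>\<^sub>F s in D. Q s) \<or> (\<forall>\<^sub>F s in D. \<not> Q s))"

definition nonprincipal :: "'s filter \<Rightarrow> bool" where
  "nonprincipal D \<longleftrightarrow> (\<forall>s. D \<noteq> principal {s})"

definition ultra_rel :: "'s filter \<Rightarrow> ('s \<Rightarrow> 'b ring) \<Rightarrow> (('s \<Rightarrow> 'b) \<times> ('s \<Rightarrow> 'b)) set" where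
  "ultra_rel D K = {(f, g). f \<in> (\<Pi> s\<in>UNIV. carrier (K s)) \<and>
                           g \<in> (\<Pi> s\<in>UNIV. carrier (K s)) \<and> (\<forall>\<^sub>F s in D. f s = g s)}"

text \<open>The operations are spelled out as relations modulo \<open>D\<close> because \<open>K s\<close> is only required to be
  a field for \<open>D\<close>-almost all \<open>s\<close>; for the other \<open>s\<close> its carrier is an arbitrary nonempty set, which
  need not be closed under the operations of the record.\<close>

definition ultraproduct :: "'s filter \<Rightarrow> ('s \<Rightarrow> 'b ring) \<Rightarrow> ('s \<Rightarrow> 'b) set ring" where
  "ultraproduct D K = \<lparr>
     carrier = (\<Pi> s\<in>UNIV. carrier (K s)) // ultra_rel D K,
     monoid.mult = (\<lambda>A B. {h \<in> (\<Pi> s\<in>UNIV. carrier (K s)).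
        \<exists>f\<in>A. \<exists>g\<in>B. \<forall>\<^sub>F s in D. h s = f s \<otimes>\<^bsub>K s\<^esub> g s}),
     one = {h \<in> (\<Pi> s\<in>UNIV. carrier (K s)). \<forall>\<^sub>F s in D. h s = \<one>\<^bsub>K s\<^esub>},
     ring.zero = {h \<in> (\<Pi> s\<in>UNIV. carrier (K s)). \<forall>\<^sub>F s in D. h s = \<zero>\<^bsub>K s\<^esub>},
     add = (\<lambda>A B. {h \<in> (\<Pi> s\<in>UNIV. carrier (K s)).
        \<exists>f\<in>A. \<exists>g\<in>B. \<forall>\<^sub>F s in D. h s = f s \<oplus>\<^bsub>K s\<^esub> g s})\<rparr>"

text \<open>\<open>ultra_finite_field D K TYPE('a)\<close>: the field \<open>'a\<close> is (isomorphic to) the ultraproduct of the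
  family \<open>K\<close> of \<open>D\<close>-almost everywhere finite fields, where \<open>D\<close> is a nonprincipal ultrafilter on an
  infinite set. A predicate of \<open>'a\<close> alone would have to quantify over the types \<open>'s\<close> and \<open>'b\<close>.\<close>

definition ultra_finite_field ::
    "'s filter \<Rightarrow> ('s \<Rightarrow> 'b ring) \<Rightarrow> 'a::Fields.field itself \<Rightarrow> bool" where
  "ultra_finite_field D K _ \<longleftrightarrow>
     infinite (UNIV :: 's set) \<and> ultrafilter D \<and> nonprincipal D \<and>
     (\<forall>s. carrier (K s) \<noteq> {}) \<and>
     (\<forall>\<^sub>F s in D. Ring.field (K s) \<and> finite (carrier (K s))) \<and>
     ultraproduct D K \<simeq> (ring_of_type_algebra :: 'a ring)"


section \<open>The valuation of a prime polynomial and the completion\<close>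

definition monic_prime :: "'a::Fields.field poly \<Rightarrow> bool" where
  "monic_prime P \<longleftrightarrow> lead_coeff P = 1 \<and> Factorial_Ring.irreducible P"

definition P_val :: "'a::Fields.field poly \<Rightarrow> 'a poly fract \<Rightarrow> int extended" where
  "P_val P x = (if x = 0 then \<infinity> else
     Fin (THE k. \<exists>f g. f \<noteq> 0 \<and> g \<noteq> 0 \<and> \<not> P dvd f \<and> \<not> P dvd g \<and>
                       x = to_fract P powi k * (to_fract f / to_fract g)))"

text \<open>The description is well-defined: every nonzero element has the required form for exactly one \<open>k\<close>.\<close>

lemma to_fract_power: "to_fract (p ^ m) = to_fract p ^ m"
  by (induction m) auto

lemma irreducible_poly_decompose:
  fixes P :: "'a::Fields.field poly"
  assumes P: "Factorial_Ring.irreducible P" and "a \<noteq> 0"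
  shows "\<exists>i f. a = P ^ i * f \<and> \<not> P dvd f"
  using \<open>a \<noteq> 0\<close>
proof (induction "Polynomial.degree a" arbitrary: a rule: less_induct)
  case less
  show ?case
  proof (cases "P dvd a")
    case True
    then obtain b where b: "a = P * b" by blast
    hence nz: "P \<noteq> 0" "b \<noteq> 0" using less.prems by auto
    have "\<not> P dvd 1" using P by (auto simp: Factorial_Ring.irreducible_def)
    hence "Polynomial.degree P > 0" using nz is_unit_iff_degree by blast
    hence "Polynomial.degree b < Polynomial.degree a"
      using nz by (simp add: b degree_mult_eq)
    from less.hyps[OF this nz(2)] obtain i f where "b = P ^ i * f" "\<not> P dvd f" by blast
    thus ?thesis using b by (intro exI[of _ "Suc i"] exI[of _ f]) (simp add: mult.assoc)
  next
    case False
    thus ?thesis by (intro exI[of _ 0] exI[of _ a]) simp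
  qed
qed

lemma P_val_unique_aux:
  fixes P :: "'a::Fields.field poly"
  assumes P: "Factorial_Ring.irreducible P"
    and nz: "f \<noteq> 0" "g \<noteq> 0" "f' \<noteq> 0" "g' \<noteq> 0"
    and nd: "\<not> P dvd f" "\<not> P dvd g" "\<not> P dvd f'" "\<not> P dvd g'"
    and eq: "to_fract P powi k * (to_fract f / to_fract g) =
             to_fract P powi l * (to_fract f' / to_fract g')"
  shows "\<not> k < l"
proof
  assume "k < l"
  have P0: "P \<noteq> 0" using P by auto
  hence P0': "to_fract P \<noteq> 0" by simp
  have pe: "prime_elem P"
    using P by (rule field_poly_irreducible_imp_prime)
  define m where "m = nat (l - k)"
  have m: "l = k + int m" "m > 0" using \<open>k < l\<close> by (auto simp: m_def)
  have "to_fract P powi l = to_fract P powi k * to_fract P ^ m"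
    using P0' by (simp add: m(1) power_int_add)
  moreover have "to_fract P powi k \<noteq> 0" using P0' by simp
  ultimately have "to_fract f / to_fract g = to_fract P ^ m * (to_fract f' / to_fract g')"
    using eq by (simp only: mult.assoc mult_cancel_left simp_thms)
  hence "to_fract f * to_fract g' = to_fract P ^ m * (to_fract f' * to_fract g)"
    using nz by (simp add: field_simps)
  hence "to_fract (f * g') = to_fract (P ^ m * (f' * g))"
    by (simp add: to_fract_mult to_fract_power)
  hence "f * g' = P ^ m * (f' * g)" by (simp only: to_fract_eq_iff)
  hence "P dvd f * g'" using m(2) by (metis dvd_mult2 dvd_power)
  thus False using pe nd by (simp add: prime_elem_dvd_mult_iff)
qed

lemma P_val_eqI:
  fixes P :: "'a::Fields.field poly"
  assumes P: "Factorial_Ring.irreducible P"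
    and nz: "f \<noteq> 0" "g \<noteq> 0" and nd: "\<not> P dvd f" "\<not> P dvd g"
  shows "P_val P (to_fract P powi k * (to_fract f / to_fract g)) = Fin k"
proof -
  have P0: "P \<noteq> 0" using P by auto
  have "(THE k'. \<exists>f' g'. f' \<noteq> 0 \<and> g' \<noteq> 0 \<and> \<not> P dvd f' \<and> \<not> P dvd g' \<and>
          to_fract P powi k * (to_fract f / to_fract g) =
          to_fract P powi k' * (to_fract f' / to_fract g')) = k"
  proof (rule the_equality)
    show "\<exists>f' g'. f' \<noteq> 0 \<and> g' \<noteq> 0 \<and> \<not> P dvd f' \<and> \<not> P dvd g' \<and>
          to_fract P powi k * (to_fract f / to_fract g) =
          to_fract P powi k * (to_fract f' / to_fract g')"
      using nz nd by blast
  next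
    fix k' assume "\<exists>f' g'. f' \<noteq> 0 \<and> g' \<noteq> 0 \<and> \<not> P dvd f' \<and> \<not> P dvd g' \<and>
          to_fract P powi k * (to_fract f / to_fract g) =
          to_fract P powi k' * (to_fract f' / to_fract g')"
    then obtain f' g' where *: "f' \<noteq> 0" "g' \<noteq> 0" "\<not> P dvd f'" "\<not> P dvd g'"
      and eq: "to_fract P powi k * (to_fract f / to_fract g) =
          to_fract P powi k' * (to_fract f' / to_fract g')" by blast
    show "k' = k"
      using P_val_unique_aux[OF P nz *(1,2) nd *(3,4) eq]
            P_val_unique_aux[OF P *(1,2) nz *(3,4) nd eq[symmetric]] by linarith
  qed
  thus ?thesis using P0 nz by (simp add: P_val_def)
qed

lemma P_val_cases:
  fixes P :: "'a::Fields.field poly"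
  assumes P: "Factorial_Ring.irreducible P" and x: "x \<noteq> 0"
  obtains k f g where "f \<noteq> 0" "g \<noteq> 0" "\<not> P dvd f" "\<not> P dvd g"
    "x = to_fract P powi k * (to_fract f / to_fract g)"
proof -
  have P0: "P \<noteq> 0" "\<not> P dvd 1" using P by (auto simp: Factorial_Ring.irreducible_def)
  obtain a b where ab: "b \<noteq> 0" "x = Fraction_Field.Fract a b" by (cases x) auto
  with x have a: "a \<noteq> 0" by (auto simp: Fraction_Field.Zero_fract_def Fraction_Field.eq_fract)
  obtain i f where f: "a = P ^ i * f" "\<not> P dvd f"
    using irreducible_poly_decompose[OF P a] by blast
  obtain j g where g: "b = P ^ j * g" "\<not> P dvd g"
    using irreducible_poly_decompose[OF P ab(1)] by blast
  have nz: "f \<noteq> 0" "g \<noteq> 0" using f g by auto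
  have "x = to_fract a / to_fract b"
    using ab by (simp add: to_fract_def)
  also have "to_fract a = to_fract P ^ i * to_fract f"
    by (subst f(1)) (simp add: to_fract_mult to_fract_power)
  also have "to_fract b = to_fract P ^ j * to_fract g"
    by (subst g(1)) (simp add: to_fract_mult to_fract_power)
  also have "to_fract P ^ i * to_fract f / (to_fract P ^ j * to_fract g) =
      to_fract P powi (int i - int j) * (to_fract f / to_fract g)"
    using P0 by (simp add: power_int_diff)
  finally show ?thesis using that nz f(2) g(2) by blast
qed

definition P_cauchy_ring :: "'a::Fields.field poly \<Rightarrow> (nat \<Rightarrow> 'a poly fract) ring" where
  "P_cauchy_ring P = \<lparr>
     carrier = {u. \<forall>N. \<exists>M. \<forall>i\<ge>M. \<forall>j\<ge>M. Fin N \<le> P_val P (u i - u j)},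
     monoid.mult = (\<lambda>u w i. u i * w i),
     one = (\<lambda>_. 1),
     ring.zero = (\<lambda>_. 0),
     add = (\<lambda>u w i. u i + w i)\<rparr>"

definition P_null_ideal :: "'a::Fields.field poly \<Rightarrow> (nat \<Rightarrow> 'a poly fract) set" where
  "P_null_ideal P = {u. \<forall>N. \<exists>M. \<forall>i\<ge>M. Fin N \<le> P_val P (u i)}"

definition P_completion :: "'a::Fields.field poly \<Rightarrow> (nat \<Rightarrow> 'a poly fract) set ring" where
  "P_completion P = P_cauchy_ring P Quot P_null_ideal P"

definition to_completion ::
    "'a::Fields.field poly \<Rightarrow> 'a poly fract \<Rightarrow> (nat \<Rightarrow> 'a poly fract) set" where
  "to_completion P x = P_null_ideal P +>\<^bsub>P_cauchy_ring P\<^esub> (\<lambda>_. x)"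

end

theory Submission
  imports Defs
begin

text \<open>The nontrivial direction deduces that \<open>\<alpha>\<close> is an \<open>n\<close>-th power from the fact that it is one modulo
all monic primes outside a finite set. The proof replaces the density theorem of Chebotarev by the
symmetry of the resultant, used in the manner of Dirichlet and Euclid.

Let \<open>F\<close> be the base field, \<open>L\<close> its algebraic closure, \<open>M\<close> the product of the exceptional primes
and \<open>E\<close> a field between \<open>F\<close> and \<open>L\<close>. For a monic \<open>f\<close> over \<open>E\<close> write \<open>Res(f, g)\<close> for the product of
\<open>g(x)\<close> over the roots \<open>x\<close> of \<open>f\<close> (\<open>root_prod\<close>). If \<open>f\<close> has no root in common with \<open>M\<close>,
then the value of \<open>\<alpha>\<close> at each root of \<open>f\<close> is the \<open>n\<close>-th power of the value of a
polynomial over \<open>F\<close>, and taking norms shows that \<open>Res(f, \<alpha>)\<close> is an \<open>n\<close>-th power in \<open>E\<close>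
(\<open>root_prod_is_power\<close>). On the other hand \<open>Res(f, \<alpha>)\<close> agrees, up to a sign and a power of the
leading coefficient of \<open>\<alpha>\<close>, with the product of \<open>f(\<beta>)\<close> over the roots \<open>\<beta>\<close> of \<open>\<alpha>\<close>. Choose \<open>E\<close>
finite over \<open>F\<close> such that it contains the roots of \<open>\<alpha>\<close> and of \<open>M\<close> and the \<open>n\<close>-th roots of
unity. Interpolation provides an \<open>f\<close> with an arbitrary nonzero value \<open>c\<close> at one root \<open>\<beta>\<close> of
multiplicity \<open>e\<close> and the value 1 at the other roots of \<open>\<alpha>\<close> and \<open>M\<close>. Hence \<open>c ^ e\<close> is an
\<open>n\<close>-th power in \<open>E\<close> for all nonzero \<open>c\<close> in \<open>E\<close> (\<open>pow_order_is_power\<close>).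

If \<open>n\<close> did not divide \<open>e\<close>, then for some divisor \<open>m > 1\<close> of \<open>n\<close> every element of \<open>E\<close> would be
an \<open>m\<close>-th power, although the \<open>m\<close>-th power map on \<open>E\<close> is not injective
(\<open>power_class_exponent_dvd\<close>). This is where the hypothesis on \<open>F\<close> enters: a surjective internal
map from a power of \<open>F\<close> to itself is injective, because this holds for maps between finite sets
(\<open>internal_surj_imp_inj\<close>), and the \<open>m\<close>-th power map on \<open>E\<close> is such a map in coordinates
(\<open>power_surj_imp_inj\<close>).

So all multiplicities of roots of \<open>\<alpha>\<close> are divisible by \<open>n\<close>, and \<open>\<alpha> = c * b ^ n\<close> with a constant
\<open>c\<close> and a monic polynomial \<open>b\<close>, which has coefficients in \<open>F\<close> because \<open>n\<close> is invertible in \<open>F\<close>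
(\<open>monic_power_root_mem\<close>). A resultant with one more test polynomial, now for \<open>E = F\<close>,
shows that \<open>c\<close> is an \<open>n\<close>-th power in \<open>F\<close> (\<open>leading_coeff_is_power\<close>).\<close>

section \<open>Polynomials over a subfield\<close>

text \<open>A subfield of a type-class field, given by its carrier. Subfields are sets and not types because
the argument below needs, inside one algebraic closure, both the base field and a finite extension
of it that depends on the polynomial under study.\<close>

locale subfield_set =
  fixes E :: "'l::Fields.field set"
  assumes zero_mem: "0 \<in> E" and one_mem: "1 \<in> E"
    and add_mem: "x \<in> E \<Longrightarrow> y \<in> E \<Longrightarrow> x + y \<in> E"
    and uminus_mem: "x \<in> E \<Longrightarrow> - x \<in> E"
    and mult_mem: "x \<in> E \<Longrightarrow> y \<in> E \<Longrightarrow> x * y \<in> E"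
    and inverse_mem: "x \<in> E \<Longrightarrow> inverse x \<in> E"
begin

lemma diff_mem: "x \<in> E \<Longrightarrow> y \<in> E \<Longrightarrow> x - y \<in> E"
  using add_mem[of x "- y"] uminus_mem by simp

lemma divide_mem: "x \<in> E \<Longrightarrow> y \<in> E \<Longrightarrow> x / y \<in> E"
  using mult_mem[of x "inverse y"] inverse_mem by (simp add: Fields.divide_inverse)

lemma power_mem: "x \<in> E \<Longrightarrow> x ^ k \<in> E"
  by (induction k) (auto intro: one_mem mult_mem)

lemma sum_mem: "(\<And>i. i \<in> I \<Longrightarrow> u i \<in> E) \<Longrightarrow> sum u I \<in> E"
  by (induction I rule: infinite_finite_induct) (auto intro: zero_mem add_mem)

lemma prod_mem: "(\<And>i. i \<in> I \<Longrightarrow> u i \<in> E) \<Longrightarrow> prod u I \<in> E"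
  by (induction I rule: infinite_finite_induct) (auto intro: one_mem mult_mem)

end

text \<open>The polynomials with all coefficients in \<open>E\<close>, as elements of the polynomial ring of the
ambient field.\<close>

definition polys_over :: "'l::zero set \<Rightarrow> 'l poly set" where
  "polys_over E = {p. \<forall>i. Polynomial.coeff p i \<in> E}"

lemma polys_overD: "p \<in> polys_over E \<Longrightarrow> Polynomial.coeff p i \<in> E"
  by (simp add: polys_over_def)

lemma polys_over_mono: "A \<subseteq> B \<Longrightarrow> polys_over A \<subseteq> polys_over B"
  by (auto simp: polys_over_def)

context subfield_set
begin

lemma polys_over_0: "0 \<in> polys_over E"
  by (simp add: polys_over_def zero_mem)

lemma polys_over_1: "1 \<in> polys_over E"
  by (simp add: polys_over_def zero_mem one_mem)

lemma polys_over_monom: "c \<in> E \<Longrightarrow> monom c k \<in> polys_over E"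
  by (simp add: polys_over_def zero_mem)

lemma polys_over_pCons: "c \<in> E \<Longrightarrow> p \<in> polys_over E \<Longrightarrow> pCons c p \<in> polys_over E"
  by (auto simp: polys_over_def coeff_pCons split: nat.splits)

lemma polys_over_add: "p \<in> polys_over E \<Longrightarrow> q \<in> polys_over E \<Longrightarrow> p + q \<in> polys_over E"
  by (simp add: polys_over_def add_mem)

lemma polys_over_diff: "p \<in> polys_over E \<Longrightarrow> q \<in> polys_over E \<Longrightarrow> p - q \<in> polys_over E"
  by (simp add: polys_over_def diff_mem)

lemma polys_over_mult: "p \<in> polys_over E \<Longrightarrow> q \<in> polys_over E \<Longrightarrow> p * q \<in> polys_over E"
  by (simp add: polys_over_def coeff_mult sum_mem mult_mem)

lemma polys_over_smult: "c \<in> E \<Longrightarrow> p \<in> polys_over E \<Longrightarrow> smult c p \<in> polys_over E"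
  by (simp add: polys_over_def mult_mem)

lemma polys_over_prod: "(\<And>i. i \<in> I \<Longrightarrow> u i \<in> polys_over E) \<Longrightarrow> prod u I \<in> polys_over E"
  by (induction I rule: infinite_finite_induct) (auto intro: polys_over_1 polys_over_mult)

lemma polys_over_divmod:
  assumes g: "g \<in> polys_over E" and f: "f \<in> polys_over E" "f \<noteq> 0"
  shows "g div f \<in> polys_over E \<and> g mod f \<in> polys_over E"
  using g
proof (induction "Polynomial.degree g" arbitrary: g rule: less_induct)
  case (less g)
  show ?case
  proof (cases "g = 0 \<or> Polynomial.degree g < Polynomial.degree f")
    case True
    thus ?thesis using less.prems by (auto simp: div_poly_less mod_poly_less polys_over_0)
  next
    case False
    define d where "d = Polynomial.degree g - Polynomial.degree f"
    define h where "h = monom (lead_coeff g / lead_coeff f) d"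
    define g' where "g' = g - h * f"
    have c: "lead_coeff g / lead_coeff f \<in> E" "lead_coeff g / lead_coeff f \<noteq> 0"
      using less.prems f False by (auto intro: divide_mem polys_overD)
    have h: "h \<in> polys_over E" "h \<noteq> 0" "Polynomial.degree h = d"
      using c(1) Polynomial.degree_monom_eq[OF c(2), of d] c(2)
      by (auto simp: h_def intro!: polys_over_monom simp del: divide_eq_0_iff)
    have g': "g' \<in> polys_over E"
      unfolding g'_def by (intro polys_over_diff polys_over_mult less.prems h f)
    have dg: "Polynomial.degree (h * f) = Polynomial.degree g"
      using h f False by (simp add: degree_mult_eq d_def)
    have lc: "lead_coeff (h * f) = lead_coeff g"
      using f c(2) by (simp add: lead_coeff_mult h_def Polynomial.degree_monom_eq)
    have IH: "g' div f \<in> polys_over E \<and> g' mod f \<in> polys_over E"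
    proof (cases "g' = 0")
      case True
      thus ?thesis by (simp add: polys_over_0)
    next
      case nz: False
      have "Polynomial.degree g' \<le> Polynomial.degree g"
        unfolding g'_def using dg by (intro degree_diff_le) auto
      moreover have "Polynomial.coeff g' (Polynomial.degree g) = 0"
        unfolding g'_def using lc dg by simp
      ultimately have "Polynomial.degree g' < Polynomial.degree g"
        using nz by (metis le_neq_implies_less leading_coeff_0_iff)
      from less.hyps[OF this g'] show ?thesis .
    qed
    have "g = g' + h * f" by (simp add: g'_def)
    hence "g div f = g' div f + h" "g mod f = g' mod f"
      using f(2) by simp_all
    thus ?thesis using IH h polys_over_add by simp
  qed
qed

end

section \<open>The product of the values of a polynomial at the roots of another\<close>

text \<open>For monic \<open>f\<close> that splits into linear factors this is the resultant of \<open>f\<close> and \<open>g\<close>: the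
product of \<open>g(x)\<close> over the roots \<open>x\<close> of \<open>f\<close>, counted with multiplicity.\<close>

definition root_prod :: "'l::Fields.field poly \<Rightarrow> 'l poly \<Rightarrow> 'l" where
  "root_prod f g = (\<Prod>x\<in>#proots f. poly g x)"

lemma root_prod_mult_left:
  "f \<noteq> 0 \<Longrightarrow> g \<noteq> 0 \<Longrightarrow> root_prod (f * g) h = root_prod f h * root_prod g h"
  by (simp add: root_prod_def proots_mult)

lemma root_prod_mult_right: "root_prod f (g * h) = root_prod f g * root_prod f h"
  by (simp add: root_prod_def prod_mset.distrib)

lemma root_prod_power_right: "root_prod f (g ^ n) = root_prod f g ^ n"
  by (induction n) (simp_all add: root_prod_mult_right, simp_all add: root_prod_def)

lemma root_prod_cong:
  "f \<noteq> 0 \<Longrightarrow> (\<And>x. poly f x = 0 \<Longrightarrow> poly g x = poly h x) \<Longrightarrow> root_prod f g = root_prod f h"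
  unfolding root_prod_def by (intro arg_cong[where f = prod_mset] image_mset_cong) auto

lemma alg_closed_monic_factorization:
  fixes f :: "'l::alg_closed_field poly"
  assumes "lead_coeff f = 1"
  shows "f = (\<Prod>x\<in>#proots f. [:-x, 1:])"
proof -
  have "f \<noteq> 0" using assms by auto
  from alg_closed_imp_factorization[OF this] obtain A where
    A: "size A = Polynomial.degree f" "f = smult (lead_coeff f) (\<Prod>x\<in>#A. [:-x, 1:])" by blast
  have "proots (\<Prod>x\<in>#A. [:-x, 1:]) = A"
  proof (induction A)
    case (add x A)
    have "(\<Prod>x\<in>#A. [:-x, 1:]) \<noteq> (0 :: 'l poly)" by (auto simp: prod_mset_zero_iff)
    hence "proots ([:-x, 1:] * (\<Prod>x\<in>#A. [:-x, 1:])) = {#x#} + A"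
      using add by (subst proots_mult) auto
    thus ?case by simp
  qed simp
  with A assms show ?thesis by (metis smult_1_left)
qed

lemma alg_closed_size_proots:
  fixes f :: "'l::alg_closed_field poly"
  assumes "lead_coeff f = 1"
  shows "size (proots f) = Polynomial.degree f"
proof -
  have "Polynomial.degree (\<Prod>x\<in>#A. [:-x, 1 :: 'l:]) = size A" for A
  proof (induction A)
    case (add x A)
    have "(\<Prod>x\<in>#A. [:-x, 1:]) \<noteq> (0 :: 'l poly)" by (auto simp: prod_mset_zero_iff)
    thus ?case using add by (simp add: degree_mult_eq del: mult_pCons_left)
  qed simp
  thus ?thesis using alg_closed_monic_factorization[OF assms] by metis
qed

lemma root_prod_smult_right:
  fixes f :: "'l::alg_closed_field poly"
  assumes "lead_coeff f = 1"
  shows "root_prod f (smult c g) = c ^ Polynomial.degree f * root_prod f g"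
  by (simp add: root_prod_def prod_mset.distrib alg_closed_size_proots[OF assms])

lemma poly_monic_eq_prod:
  fixes f :: "'l::alg_closed_field poly"
  assumes "lead_coeff f = 1"
  shows "poly f z = (\<Prod>x\<in>#proots f. z - x)"
proof -
  have "poly (\<Prod>x\<in>#A. [:-x, 1:]) z = (\<Prod>x\<in>#A. z - x)" for A
    by (induction A) (auto simp: algebra_simps)
  thus ?thesis using alg_closed_monic_factorization[OF assms] by metis
qed

lemma prod_mset_uminus: 
  "(\<Prod>x\<in>#A. - u x :: 'l::Fields.field) = (- 1) ^ size A * (\<Prod>x\<in>#A. u x)"
  by (induction A) auto

text \<open>The symmetry of the resultant, which plays the part of the reciprocity law for power residue
symbols.\<close>

lemma root_prod_swap:
  fixes f g :: "'l::alg_closed_field poly"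
  assumes f: "lead_coeff f = 1" and g: "lead_coeff g = 1"
  shows "root_prod f g = (- 1) ^ (Polynomial.degree f * Polynomial.degree g) * root_prod g f"
proof -
  have "root_prod f g = (\<Prod>x\<in>#proots f. \<Prod>y\<in>#proots g. - (y - x))"
    by (simp add: root_prod_def poly_monic_eq_prod[OF g])
  also have "\<dots> = (\<Prod>y\<in>#proots g. \<Prod>x\<in>#proots f. - (y - x))"
    by (rule prod_mset.swap)
  also have "\<dots> = (\<Prod>y\<in>#proots g. (- 1) ^ Polynomial.degree f * poly f y)"
    by (simp only: prod_mset_uminus alg_closed_size_proots[OF f] poly_monic_eq_prod[OF f])
  also have "\<dots> = (- 1) ^ (Polynomial.degree f * Polynomial.degree g) * root_prod g f"
    by (simp add: root_prod_def prod_mset.distrib alg_closed_size_proots[OF g] power_mult)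
  finally show ?thesis .
qed

lemma root_prod_smult_swap:
  fixes f g :: "'l::alg_closed_field poly"
  assumes f: "lead_coeff f = 1" and g: "g \<noteq> 0"
  shows "root_prod f g = lead_coeff g ^ Polynomial.degree f *
    ((- 1) ^ (Polynomial.degree f * Polynomial.degree g) * root_prod g f)"
proof -
  define c where "c = lead_coeff g"
  define g' where "g' = smult (inverse c) g"
  have c: "c \<noteq> 0" using g by (simp add: c_def)
  have g': "lead_coeff g' = 1" "Polynomial.degree g' = Polynomial.degree g" "g = smult c g'"
    "proots g' = proots g"
    using c by (auto simp: g'_def c_def)
  have "root_prod f g = c ^ Polynomial.degree f * root_prod f g'"
    by (subst g'(3)) (rule root_prod_smult_right[OF f])
  also have "root_prod f g' = (- 1) ^ (Polynomial.degree f * Polynomial.degree g) * root_prod g f"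
    using root_prod_swap[OF f g'(1)] g'(2,4) by (simp add: root_prod_def)
  finally show ?thesis by (simp add: c_def)
qed

lemma monic_degree_0:
  assumes "lead_coeff f = 1" "Polynomial.degree f = 0"
  shows "f = (1 :: 'l::Fields.field poly)"
  using assms by (metis degree_0_id of_nat_eq_id of_nat_1 one_pCons)

text \<open>The same notion as \<open>subfield_set\<close>, but inside an algebraically closed field, where
\<open>root_prod f\<close> sees all roots of \<open>f\<close>.\<close>

locale alg_closed_subfield_set = subfield_set E for E :: "'l::alg_closed_field set"
begin

text \<open>The resultant of polynomials over \<open>E\<close> lies in \<open>E\<close>. The induction is the Euclidean
algorithm: \<open>g\<close> may be replaced by its remainder modulo \<open>f\<close>, after which the symmetry of the
resultant decreases the degree of the first argument.\<close>

lemma root_prod_mem: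
  assumes "f \<in> polys_over E" "g \<in> polys_over E" "lead_coeff f = 1"
  shows "root_prod f g \<in> E"
  using assms
proof (induction "Polynomial.degree f" arbitrary: f g rule: less_induct)
  case (less f g)
  have f0: "f \<noteq> 0" using less.prems by auto
  define r where "r = g mod f"
  have r: "r \<in> polys_over E" using polys_over_divmod less.prems f0 by (auto simp: r_def)
  have "root_prod f g = root_prod f r"
  proof (rule root_prod_cong[OF f0])
    fix x assume "poly f x = 0"
    moreover have "g = g div f * f + r" by (simp add: r_def)
    ultimately show "poly g x = poly r x" by (metis poly_add poly_mult mult_zero_right add_0)
  qed
  also have "\<dots> \<in> E"
  proof (cases "r = 0")
    case True
    thus ?thesis by (cases "proots f") (auto simp: root_prod_def one_mem zero_mem)
  next
    case False
    define c where "c = lead_coeff r"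
    define r' where "r' = smult (inverse c) r"
    have c: "c \<noteq> 0" "c \<in> E" using False r by (auto simp: c_def polys_overD)
    have r': "lead_coeff r' = 1" "Polynomial.degree r' = Polynomial.degree r"
      "proots r' = proots r" "r' \<in> polys_over E"
      using c r by (auto simp: r'_def c_def intro!: polys_over_smult inverse_mem)
    have "Polynomial.degree f \<noteq> 0"
      using False less.prems(3) by (auto simp: r_def dest: monic_degree_0)
    hence "Polynomial.degree r < Polynomial.degree f"
      unfolding r_def using f0 degree_mod_less' False r_def by blast
    hence "root_prod r' f \<in> E" using less.hyps r' less.prems by metis
    hence "root_prod r f \<in> E" using r' by (simp add: root_prod_def)
    thus ?thesis
      unfolding root_prod_smult_swap[OF less.prems(3) False] using c(2)
      by (intro mult_mem power_mem uminus_mem one_mem) (auto simp: c_def)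
  qed
  finally show ?case .
qed

lemma exists_minimal_poly:
  assumes "f \<in> polys_over E" "lead_coeff f = 1" "poly f \<theta> = 0"
  obtains q where "q \<in> polys_over E" "lead_coeff q = 1" "poly q \<theta> = 0"
    "\<And>p. p \<in> polys_over E \<Longrightarrow> poly p \<theta> = 0 \<Longrightarrow> q dvd p"
proof -
  define Q where "Q q \<longleftrightarrow> q \<in> polys_over E \<and> q \<noteq> 0 \<and> poly q \<theta> = 0" for q
  have "Q f" using assms by (auto simp: Q_def)
  then obtain q where q: "Q q" and min: "\<And>p. Q p \<Longrightarrow> Polynomial.degree q \<le> Polynomial.degree p"
    using ex_has_least_nat[of Q f Polynomial.degree] by auto
  define q' where "q' = smult (inverse (lead_coeff q)) q"
  have q0: "lead_coeff q \<noteq> 0" "q \<in> polys_over E" "poly q \<theta> = 0" using q by (auto simp: Q_def)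
  have q': "q' \<in> polys_over E" "lead_coeff q' = 1" "poly q' \<theta> = 0" "q' \<noteq> 0"
    "Polynomial.degree q' = Polynomial.degree q"
    using q0 by (auto simp: q'_def intro!: polys_over_smult inverse_mem polys_overD)
  show thesis
  proof (rule that[of q'])
    fix p assume p: "p \<in> polys_over E" "poly p \<theta> = 0"
    have "p = p div q' * q' + p mod q'" by simp
    hence "poly (p mod q') \<theta> = 0" using p(2) q'(3)
      by (metis poly_add poly_mult mult_zero_right add_0)
    moreover have "p mod q' \<in> polys_over E" using polys_over_divmod p(1) q' by blast
    ultimately have "p mod q' = 0 \<or> Polynomial.degree q' \<le> Polynomial.degree (p mod q')"
      using min[of "p mod q'"] q'(5) by (auto simp: Q_def)
    thus "q' dvd p" using degree_mod_less'[of q' p] q'(4) unfolding dvd_eq_mod_eq_0 by linarith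
  qed (use q' in auto)
qed

text \<open>If at every root of \<open>f\<close> the value of \<open>a\<close> is an \<open>n\<close>-th power for an algebraic reason, valid at
all conjugates of that root, then the resultant of \<open>f\<close> and \<open>a\<close> is an \<open>n\<close>-th power in \<open>E\<close>.
This expresses that the norm of an \<open>n\<close>-th power is an \<open>n\<close>-th power; \<open>a\<close> itself need not have
coefficients in \<open>E\<close>.\<close>

lemma root_prod_is_power:
  assumes "f \<in> polys_over E" "lead_coeff f = 1"
    and "\<And>\<theta>. poly f \<theta> = 0 \<Longrightarrow> \<exists>P\<in>polys_over E. \<exists>g\<in>polys_over E.
           poly P \<theta> = 0 \<and> (\<forall>z. poly P z = 0 \<longrightarrow> poly a z = poly g z ^ n)"
  shows "\<exists>y\<in>E. root_prod f a = y ^ n"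
  using assms
proof (induction "Polynomial.degree f" arbitrary: f rule: less_induct)
  case (less f)
  show ?case
  proof (cases "Polynomial.degree f = 0")
    case True
    hence "f = 1" using monic_degree_0 less.prems by blast
    thus ?thesis by (intro bexI[of _ 1]) (auto simp: root_prod_def one_mem)
  next
    case False
    then obtain \<theta> where \<theta>: "poly f \<theta> = 0" using alg_closed_imp_poly_has_root by blast
    obtain q where q: "q \<in> polys_over E" "lead_coeff q = 1" "poly q \<theta> = 0"
      "\<And>p. p \<in> polys_over E \<Longrightarrow> poly p \<theta> = 0 \<Longrightarrow> q dvd p"
      using exists_minimal_poly less.prems(1,2) \<theta> by blast
    obtain P g where P: "P \<in> polys_over E" "g \<in> polys_over E" "poly P \<theta> = 0"
      "\<And>z. poly P z = 0 \<Longrightarrow> poly a z = poly g z ^ n"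
      using less.prems(3)[OF \<theta>] by blast
    have "q \<noteq> 0" using q by auto
    \<comment> \<open>The roots of q, which are the conjugates of the chosen root over E, are roots of P,
      so the same g serves all of them.\<close>
    have "q dvd P" using q(4) P by blast
    hence "root_prod q a = root_prod q (g ^ n)"
      using P(4) \<open>q \<noteq> 0\<close> by (intro root_prod_cong) (auto simp: poly_power elim: dvdE)
    hence A: "root_prod q a = root_prod q g ^ n" by (simp add: root_prod_power_right)
    have B: "root_prod q g \<in> E" by (intro root_prod_mem q P)
    define h where "h = f div q"
    have h: "f = q * h" using q(4)[OF less.prems(1) \<theta>] by (simp add: h_def)
    have hE: "h \<in> polys_over E" unfolding h_def
      using polys_over_divmod less.prems(1) q(1) \<open>q \<noteq> 0\<close> by blast
    have h1: "lead_coeff h = 1" using h q(2) less.prems(2) by (simp add: lead_coeff_mult)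
    hence "h \<noteq> 0" by auto
    have "Polynomial.degree q \<noteq> 0" using q(2,3) monic_degree_0[of q] by (metis poly_1 zero_neq_one)
    hence "Polynomial.degree h < Polynomial.degree f"
      unfolding h using \<open>h \<noteq> 0\<close> \<open>q \<noteq> 0\<close> by (simp add: degree_mult_eq)
    moreover have "poly f z = 0" if "poly h z = 0" for z using that h by simp
    ultimately obtain y where y: "y \<in> E" "root_prod h a = y ^ n"
      using less.hyps[OF _ hE h1] less.prems(3) by blast
    have "root_prod f a = (root_prod q g * y) ^ n"
      unfolding h root_prod_mult_left[OF \<open>q \<noteq> 0\<close> \<open>h \<noteq> 0\<close>] A y(2) by (simp add: power_mult_distrib)
    thus ?thesis using B y mult_mem by blast
  qed
qed

end

section \<open>Multiplicities of roots from power conditions\<close>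

context alg_closed_subfield_set
begin

text \<open>Reciprocity combined with the Chinese remainder theorem: a monic \<open>f\<close> over \<open>E\<close> with
\<open>f(\<beta>) = c\<close> that takes the value 1 at all other roots of \<open>\<alpha>\<close> and of \<open>M\<close> has resultant
\<open>c ^ order \<beta> \<alpha>\<close> with \<open>\<alpha>\<close>, up to \<open>n\<close>-th powers.\<close>

lemma pow_order_is_power:
  fixes \<alpha> M :: "'l poly"
  assumes \<alpha>: "\<alpha> \<in> polys_over E" "\<alpha> \<noteq> 0" and M: "M \<noteq> 0"
    and roots: "\<And>z. poly (\<alpha> * M) z = 0 \<Longrightarrow> z \<in> E"
    and pow: "\<And>f. f \<in> polys_over E \<Longrightarrow> lead_coeff f = 1 \<Longrightarrow>
       (\<And>z. poly f z = 0 \<Longrightarrow> poly M z \<noteq> 0) \<Longrightarrow> \<exists>y\<in>E. root_prod f \<alpha> = y ^ n"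
    and \<beta>: "poly \<alpha> \<beta> = 0" and c: "c \<in> E" "c \<noteq> 0" and n: "n > 0"
  shows "\<exists>z\<in>E. c ^ Polynomial.order \<beta> \<alpha> = z ^ n"
proof -
  define Z where "Z = {z. poly (\<alpha> * M) z = 0}"
  have fin: "finite Z" unfolding Z_def by (rule poly_roots_finite) (use \<alpha> M in simp)
  have \<beta>Z: "\<beta> \<in> Z" using \<beta> by (simp add: Z_def)
  have ZE: "z \<in> E" if "z \<in> Z" for z using that roots by (auto simp: Z_def)
  have cZ: "card Z > 0" using fin \<beta>Z card_gt_0_iff by blast
  define A where "A = (\<Prod>z\<in>Z. [:-z, 1:])"
  define J where "J = (\<Prod>z\<in>Z - {\<beta>}. [:-z, 1:])"
  define I where "I = 1 + smult ((c - 1) / poly J \<beta>) J"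
  \<comment> \<open>The degree of f is a multiple of 2 n, so the sign in the symmetry law is 1
    and the power of the leading coefficient of alpha is an n-th power.\<close>
  define f where "f = monom 1 ((2 * n - 1) * card Z) * A + I"
  have lin: "[:-z, 1:] \<in> polys_over E" if "z \<in> Z" for z
    using that by (intro polys_over_pCons uminus_mem ZE one_mem polys_over_0)
  have AE: "A \<in> polys_over E" unfolding A_def by (intro polys_over_prod lin)
  have JE: "J \<in> polys_over E" unfolding J_def by (intro polys_over_prod lin) auto
  have J\<beta>: "poly J \<beta> = (\<Prod>z\<in>Z - {\<beta>}. \<beta> - z)" by (simp add: J_def poly_prod)
  have J\<beta>0: "poly J \<beta> \<noteq> 0" unfolding J\<beta> using fin by simp
  have J\<beta>E: "poly J \<beta> \<in> E" unfolding J\<beta> using ZE \<beta>Z by (intro prod_mem diff_mem) auto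
  have IE: "I \<in> polys_over E" unfolding I_def
    by (intro polys_over_add polys_over_1 polys_over_smult divide_mem diff_mem one_mem c J\<beta>E JE)
  have fE: "f \<in> polys_over E" unfolding f_def
    by (intro polys_over_add polys_over_mult polys_over_monom one_mem AE IE)
  have dA: "Polynomial.degree A = card Z" unfolding A_def
    by (subst degree_prod_eq_sum_degree) (auto)
  have lA: "lead_coeff A = 1" unfolding A_def by (simp add: lead_coeff_prod)
  have dJ: "Polynomial.degree J = card Z - 1" unfolding J_def
    by (subst degree_prod_eq_sum_degree) (auto simp: \<beta>Z fin)
  have dI: "Polynomial.degree I < card Z"
  proof -
    have "Polynomial.degree I \<le> card Z - 1"
      unfolding I_def using dJ by (intro degree_add_le order.trans[OF degree_smult_le]) auto
    thus ?thesis using cZ by linarith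
  qed
  define g where "g = monom 1 ((2 * n - 1) * card Z) * A"
  have g: "lead_coeff g = 1" unfolding g_def
    using lA by (simp add: lead_coeff_mult Polynomial.degree_monom_eq)
  have fg: "f = g + I" by (simp add: f_def g_def)
  have A0: "A \<noteq> 0" using lA by auto
  have dg: "Polynomial.degree g = 2 * n * card Z"
  proof -
    have "Polynomial.degree g = (2 * n - 1) * card Z + card Z"
      unfolding g_def using A0 by (subst degree_mult_eq) (auto simp: dA Polynomial.degree_monom_eq)
    also have "\<dots> = 2 * n * card Z" using n by (cases n) auto
    finally show ?thesis .
  qed
  have "card Z \<le> 2 * n * card Z" using n by simp
  hence "Polynomial.degree I < Polynomial.degree g" using dI dg by linarith
  hence f: "Polynomial.degree f = 2 * n * card Z" "lead_coeff f = 1"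
    using g dg by (auto simp: fg degree_add_eq_left coeff_eq_0)
  have fz: "poly f z = (if z = \<beta> then c else 1)" if "z \<in> Z" for z
  proof -
    have "poly A z = 0" using fin that by (auto simp: A_def poly_prod)
    moreover have "poly J z = 0" if "z \<noteq> \<beta>"
      using fin that \<open>z \<in> Z\<close> by (auto simp: J_def poly_prod)
    ultimately show ?thesis using J\<beta>0 by (auto simp: f_def I_def)
  qed
  have "poly M z \<noteq> 0" if "poly f z = 0" for z
    using fz[of z] that c by (auto simp: Z_def split: if_splits)
  from pow[OF fE f(2) this] obtain y where y: "y \<in> E" "root_prod f \<alpha> = y ^ n" by blast
  have "root_prod \<alpha> f = (\<Prod>x\<in>#proots \<alpha>. if x = \<beta> then c else 1)"
    unfolding root_prod_def using \<alpha> fz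
    by (intro arg_cong[where f = prod_mset] image_mset_cong) (auto simp: Z_def)
  also have "\<dots> = c ^ Polynomial.order \<beta> \<alpha>"
    using \<alpha> by (simp add: prod_mset_delta)
  finally have R: "root_prod \<alpha> f = c ^ Polynomial.order \<beta> \<alpha>" .
  define l where "l = lead_coeff \<alpha>"
  have l: "l \<in> E" "l \<noteq> 0" using \<alpha> by (auto simp: l_def polys_overD)
  have "y ^ n = (l ^ (2 * card Z)) ^ n * c ^ Polynomial.order \<beta> \<alpha>"
    using y(2) root_prod_smult_swap[OF f(2) \<alpha>(2)] unfolding R f(1) l_def[symmetric]
    by (simp add: mult.assoc flip: power_mult) (simp add: mult.commute mult.left_commute)
  hence "c ^ Polynomial.order \<beta> \<alpha> = (y / l ^ (2 * card Z)) ^ n"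
    using l(2) by (simp add: power_divide field_simps)
  thus ?thesis using l y by (intro bexI[of _ "y / l ^ (2 * card Z)"] divide_mem power_mem) auto
qed

text \<open>Let \<open>E\<close> contain the \<open>n\<close>-th roots of unity, and suppose that a power map on \<open>E\<close> is injective as
soon as it is surjective, as holds for finite fields. If \<open>c ^ e\<close> is an \<open>n\<close>-th power for every
nonzero \<open>c\<close>, then so is \<open>c ^ gcd e n\<close>, and extracting a root shows that every \<open>c\<close> is an
\<open>m\<close>-th power with \<open>m = n / gcd e n\<close>. The presence of a nontrivial \<open>m\<close>-th root of unity for
\<open>m > 1\<close> then leaves only \<open>m = 1\<close>.\<close>

lemma power_class_exponent_dvd:
  assumes n: "n > 0" "of_nat n \<noteq> (0 :: 'l)"
    and \<mu>: "\<And>z. z ^ n = 1 \<Longrightarrow> z \<in> E"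
    and surj_inj: "\<And>m. (\<forall>c\<in>E. \<exists>z\<in>E. c = z ^ m) \<Longrightarrow> inj_on (\<lambda>z. z ^ m) E"
    and pow: "\<And>c. c \<in> E \<Longrightarrow> c \<noteq> 0 \<Longrightarrow> \<exists>z\<in>E. c ^ e = z ^ n"
  shows "n dvd e"
proof (cases "e = 0")
  case False
  define d where "d = gcd e n"
  define m where "m = n div d"
  have nmd: "n = m * d" by (simp add: m_def d_def)
  have m0: "m > 0" "d > 0" using nmd n by (auto intro!: Nat.gr0I)
  have "m = 1"
  proof (rule ccontr)
    assume "m \<noteq> 1"
    hence m1: "m > 1" using m0 by simp
    have "\<exists>z\<in>E. c = z ^ m" if c: "c \<in> E" for c
    proof (cases "c = 0")
      case True
      thus ?thesis using m0 by (intro bexI[of _ 0]) (auto simp: zero_mem)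
    next
      case c0: False
      obtain z where z: "z \<in> E" "c ^ e = z ^ n" using pow c c0 by blast
      obtain u v where uv: "e * u = n * v + d"
        using bezout_nat[OF False, of n] by (auto simp: d_def)
      define y where "y = z ^ u / c ^ v"
      have yE: "y \<in> E" unfolding y_def using z c by (intro divide_mem power_mem)
      have "c ^ d * (c ^ v) ^ n = (c ^ e) ^ u"
        using uv by (metis add.commute mult.commute power_add power_mult)
      also have "\<dots> = (z ^ u) ^ n" by (simp add: z(2) mult.commute flip: power_mult)
      finally have cd: "c ^ d = y ^ n" using c0 by (simp add: y_def power_divide field_simps)
      hence y0: "y \<noteq> 0" using c0 n(1) by (auto simp: power_0_left)
      define \<zeta> where "\<zeta> = c / y ^ m"
      have "\<zeta> ^ d = 1" using cd y0 by (simp add: \<zeta>_def power_divide nmd power_mult)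
      obtain \<eta> where \<eta>: "\<eta> ^ m = \<zeta>" using nth_root_exists[of m \<zeta>] m0 by blast
      have "\<eta> ^ n = 1" using \<eta> \<open>\<zeta> ^ d = 1\<close> by (simp add: nmd power_mult)
      hence "\<eta> * y \<in> E" using \<mu> yE mult_mem by blast
      moreover have "c = (\<eta> * y) ^ m" using \<eta> y0 by (simp add: power_mult_distrib \<zeta>_def)
      ultimately show ?thesis by blast
    qed
    hence inj: "inj_on (\<lambda>z. z ^ m) E" using surj_inj by blast
    \<comment> \<open>A root of 1 + t + ... + t^(m - 1) is an m-th root of unity;
      it is not 1 because m is nonzero in the field.\<close>
    obtain w :: 'l where w: "(\<Sum>k\<le>m - 1. 1 * w ^ k) = 0"
      using alg_closed[of "m - 1" "\<lambda>_. 1 :: 'l"] m1 by auto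
    have "(1 - w) * (\<Sum>k\<le>m - 1. w ^ k) = 1 - w ^ Suc (m - 1)" by (rule sum_gp_basic)
    hence wm: "w ^ m = 1" using w m0 by simp
    hence "w \<in> E" using \<mu> nmd by (simp add: power_mult)
    hence "w = 1" using inj wm one_mem by (auto dest!: inj_onD[where x = w and y = 1])
    hence "of_nat m = (0 :: 'l)" using w m0 by (simp add: of_nat_diff)
    thus False using n(2) nmd by simp
  qed
  thus ?thesis using nmd by (simp add: d_def) (metis gcd_dvd1)
qed simp

text \<open>The test polynomial is \<open>f = t ^ k * A + 1\<close>, where \<open>A\<close> is \<open>M * b\<close> made monic and \<open>k\<close> is chosen such
that the degree of \<open>f\<close> is 1 modulo \<open>n\<close>; the resultant of \<open>f\<close> and \<open>c * b ^ n\<close> is then \<open>c\<close>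
times an \<open>n\<close>-th power. No supply of primes of a prescribed degree is needed, so finite and infinite
fields are covered alike.\<close>

lemma leading_coeff_is_power:
  fixes b M :: "'l poly"
  assumes b: "b \<in> polys_over E" "lead_coeff b = 1" and M: "M \<in> polys_over E" "M \<noteq> 0"
    and c: "c \<noteq> 0" "c \<in> E" and n: "n > 0"
    and pow: "\<And>f. f \<in> polys_over E \<Longrightarrow> lead_coeff f = 1 \<Longrightarrow>
       (\<And>z. poly f z = 0 \<Longrightarrow> poly M z \<noteq> 0) \<Longrightarrow> \<exists>y\<in>E. root_prod f (smult c (b ^ n)) = y ^ n"
  shows "\<exists>y\<in>E. c = y ^ n"
proof -
  define A where "A = smult (inverse (lead_coeff M)) (M * b)"
  have b0: "b \<noteq> 0" using b by auto
  have A: "A \<in> polys_over E" "lead_coeff A = 1"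
    using b M by (auto simp: A_def lead_coeff_mult intro!: polys_over_smult polys_over_mult
      inverse_mem polys_overD)
  define D where "D = Polynomial.degree A"
  define g where "g = monom 1 (D * (n - 1) + 1) * A"
  define f where "f = g + 1"
  have A0: "A \<noteq> 0" using A(2) by auto
  have dg: "Polynomial.degree g = n * D + 1"
    unfolding g_def using A0 n
    by (subst degree_mult_eq) (auto simp: Polynomial.degree_monom_eq D_def[symmetric] algebra_simps
        diff_mult_distrib2 intro!: le_add_diff_inverse2)
  have lg: "lead_coeff g = 1"
    unfolding g_def using A by (simp add: lead_coeff_mult Polynomial.degree_monom_eq)
  have gE: "g \<in> polys_over E"
    unfolding g_def by (intro polys_over_mult polys_over_monom one_mem A)
  have df: "Polynomial.degree f = n * D + 1"
    unfolding f_def using dg by (subst degree_add_eq_left) auto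
  have lf: "lead_coeff f = 1" using lg dg df by (simp add: f_def)
  have fE: "f \<in> polys_over E" unfolding f_def by (intro polys_over_add gE polys_over_1)
  have nr: "poly M z \<noteq> 0 \<and> poly b z \<noteq> 0" if "poly f z = 0" for z
    using that by (auto simp: f_def g_def A_def)
  obtain y where y: "y \<in> E" "root_prod f (smult c (b ^ n)) = y ^ n"
    using pow[OF fE lf] nr by blast
  define R where "R = root_prod f b"
  have f0: "f \<noteq> 0" using lf by auto
  have R: "R \<in> E" "R \<noteq> 0"
    using root_prod_mem[OF fE b(1) lf] nr f0 by (auto simp: R_def root_prod_def prod_mset_zero_iff)
  have "y ^ n = (c ^ D * R) ^ n * c"
    using y(2) unfolding root_prod_smult_right[OF lf] root_prod_power_right df R_def[symmetric]
    by (simp add: power_mult_distrib mult_ac flip: power_mult)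
  hence "c = (y / (c ^ D * R)) ^ n"
    using c R by (simp add: power_divide field_simps)
  thus ?thesis using y R c by (intro bexI[of _ "y / (c ^ D * R)"] divide_mem mult_mem power_mem)
qed

end

text \<open>A monic \<open>n\<close>-th root of a polynomial over \<open>E\<close> has coefficients in \<open>E\<close> if \<open>n\<close> is invertible:
for a monic \<open>U\<close> over \<open>E\<close> as close as possible to \<open>B\<close>, the leading coefficient of
\<open>B ^ n - U ^ n\<close> is \<open>n\<close> times that of \<open>B - U\<close>, so that the approximation \<open>U\<close> could be
improved.\<close>

lemma (in subfield_set) monic_power_root_mem:
  fixes B :: "'l poly"
  assumes B: "lead_coeff B = 1" and n: "of_nat n \<noteq> (0 :: 'l)" and Bn: "B ^ n \<in> polys_over E"
  shows "B \<in> polys_over E"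
proof (rule ccontr)
  assume nB: "B \<notin> polys_over E"
  define D where "D = Polynomial.degree B"
  define Q where "Q U \<longleftrightarrow> U \<in> polys_over E \<and> lead_coeff U = 1 \<and> Polynomial.degree U = D" for U
  have "Q (monom 1 D)"
    by (auto simp: Q_def Polynomial.degree_monom_eq intro: polys_over_monom one_mem)
  then obtain U where U: "Q U"
    and min: "\<And>W. Q W \<Longrightarrow> Polynomial.degree (B - U) \<le> Polynomial.degree (B - W)"
    using ex_has_least_nat[of Q "monom 1 D" "\<lambda>U. Polynomial.degree (B - U)"] by auto
  define V where "V = B - U"
  define v where "v = Polynomial.degree V"
  have V0: "V \<noteq> 0" using U nB by (auto simp: V_def Q_def)
  have vD: "v < D"
  proof -
    have "v \<le> D" unfolding v_def V_def using U by (intro degree_diff_le) (auto simp: Q_def D_def)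
    moreover have "Polynomial.coeff V D = 0" using U B by (auto simp: V_def Q_def D_def)
    ultimately show ?thesis using V0 unfolding v_def by (metis le_neq_implies_less leading_coeff_0_iff)
  qed
  define S where "S = (\<Sum>i<n. U ^ (n - Suc i) * B ^ i)"
  have nz: "U \<noteq> 0" "B \<noteq> 0" using U B by (auto simp: Q_def)
  have tm: "Polynomial.degree (U ^ (n - Suc i) * B ^ i) = (n - 1) * D \<and>
      Polynomial.coeff (U ^ (n - Suc i) * B ^ i) ((n - 1) * D) = 1" if "i < n" for i
  proof -
    have "Polynomial.degree (U ^ (n - Suc i) * B ^ i) = (n - Suc i) * D + i * D"
      using nz U by (simp add: degree_mult_eq degree_power_eq Q_def D_def)
    also have "\<dots> = (n - 1) * D" using that by (simp flip: add_mult_distrib)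
    finally have deg: "Polynomial.degree (U ^ (n - Suc i) * B ^ i) = (n - 1) * D" .
    have "lead_coeff (U ^ (n - Suc i) * B ^ i) = 1"
      unfolding lead_coeff_mult lead_coeff_power using U B by (auto simp: Q_def)
    thus ?thesis using deg by simp
  qed
  have S1: "Polynomial.coeff S ((n - 1) * D) = of_nat n"
    unfolding S_def coeff_sum using tm by simp
  moreover have "Polynomial.degree S \<le> (n - 1) * D"
    unfolding S_def using tm by (intro degree_sum_le) auto
  ultimately have dS: "Polynomial.degree S = (n - 1) * D"
    using n by (intro antisym le_degree) auto
  have "B ^ n - U ^ n = V * S" unfolding V_def S_def by (rule power_diff_sumr2)
  moreover have "U ^ n \<in> polys_over E"
    using U by (induction n) (auto intro: polys_over_mult polys_over_1 simp: Q_def)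
  ultimately have "V * S \<in> polys_over E" using Bn polys_over_diff by metis
  moreover have "Polynomial.coeff (V * S) (v + Polynomial.degree S) = lead_coeff V * of_nat n"
    unfolding v_def coeff_mult_degree_sum using S1 dS by simp
  ultimately have "lead_coeff V * of_nat n \<in> E" by (metis polys_overD)
  moreover have "of_nat n \<in> E" by (induction n) (auto intro: zero_mem one_mem add_mem)
  ultimately have "lead_coeff V * of_nat n / of_nat n \<in> E" by (rule divide_mem)
  hence lV: "lead_coeff V \<in> E" using n by simp
  define W where "W = U + monom (lead_coeff V) v"
  have "Polynomial.degree (monom (lead_coeff V) v) < Polynomial.degree U"
    using U vD V0 by (simp add: Polynomial.degree_monom_eq Q_def)
  hence "Q W" using U vD lV
    by (auto simp: Q_def W_def degree_add_eq_left coeff_eq_0 intro!: polys_over_add polys_over_monom)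
  have BW: "B - W = V - monom (lead_coeff V) v" by (simp add: W_def V_def)
  have "B - W \<noteq> 0" using \<open>Q W\<close> nB by (auto simp: Q_def)
  moreover have "Polynomial.coeff (B - W) v = 0" unfolding BW by (simp add: v_def)
  moreover have "Polynomial.degree (B - W) \<le> v"
    unfolding BW using V0 by (intro degree_diff_le) (auto simp: Polynomial.degree_monom_eq v_def)
  ultimately have "Polynomial.degree (B - W) < v"
    by (metis le_neq_implies_less leading_coeff_0_iff)
  thus False using min[OF \<open>Q W\<close>] by (simp add: v_def V_def)
qed

lemma exists_power_of_order_dvd:
  fixes \<alpha> :: "'l::alg_closed_field poly"
  assumes "\<alpha> \<noteq> 0" and ord: "\<And>x. poly \<alpha> x = 0 \<Longrightarrow> n dvd Polynomial.order x \<alpha>"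
  obtains B where "lead_coeff B = 1" "\<alpha> = smult (lead_coeff \<alpha>) (B ^ n)"
proof -
  define c where "c = lead_coeff \<alpha>"
  define \<alpha>' where "\<alpha>' = smult (inverse c) \<alpha>"
  have c: "c \<noteq> 0" using assms by (simp add: c_def)
  have \<alpha>': "lead_coeff \<alpha>' = 1" "proots \<alpha>' = proots \<alpha>" "\<alpha> = smult c \<alpha>'" "\<alpha>' \<noteq> 0"
    using c assms by (auto simp: \<alpha>'_def c_def)
  define B where "B = (\<Prod>x | poly \<alpha> x = 0. [:-x, 1:] ^ (Polynomial.order x \<alpha> div n))"
  have "\<alpha>' = (\<Prod>x\<in>#proots \<alpha>. [:-x, 1:])"
    using alg_closed_monic_factorization[OF \<alpha>'(1)] \<alpha>'(2) by simp
  also have "\<dots> = (\<Prod>x | poly \<alpha> x = 0. [:-x, 1:] ^ Polynomial.order x \<alpha>)"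
    unfolding image_prod_mset_multiplicity using assms(1) by simp
  also have "\<dots> = (\<Prod>x | poly \<alpha> x = 0. ([:-x, 1:] ^ (Polynomial.order x \<alpha> div n)) ^ n)"
    using ord by (intro prod.cong) (auto simp flip: power_mult)
  also have "\<dots> = B ^ n" by (simp add: B_def prod_power_distrib)
  finally have "\<alpha> = smult c (B ^ n)" using \<alpha>'(3) by simp
  moreover have "lead_coeff B = 1" unfolding B_def lead_coeff_prod by (simp add: lead_coeff_power)
  ultimately show ?thesis using that by (simp add: c_def)
qed

section \<open>Internal maps on ultraproducts\<close>

text \<open>A field presented as an ultraproduct: \<open>\<Phi>\<close> sends a sequence in the product of the carriers
to the field element that it represents. The laws for addition and multiplication quantify over a
result \<open>z\<close> because for a negligible set of indices \<open>s\<close> the carrier of \<open>K s\<close> need not be closed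
under the operations.\<close>

locale ultraproduct_coords =
  fixes D :: "'s filter" and K :: "'s \<Rightarrow> 'b ring" and \<Phi> :: "('s \<Rightarrow> 'b) \<Rightarrow> 'a::Fields.field"
  assumes ultra: "ultrafilter D"
    and nonempty: "\<And>s. carrier (K s) \<noteq> {}"
    and ev_field: "\<forall>\<^sub>F s in D. Ring.field (K s)"
    and ev_finite: "\<forall>\<^sub>F s in D. finite (carrier (K s))"
    and \<Phi>_eq_iff: "\<And>x y. (\<And>s. x s \<in> carrier (K s)) \<Longrightarrow> (\<And>s. y s \<in> carrier (K s)) \<Longrightarrow>
          \<Phi> x = \<Phi> y \<longleftrightarrow> (\<forall>\<^sub>F s in D. x s = y s)"
    and \<Phi>_surj: "\<And>a. \<exists>x. (\<forall>s. x s \<in> carrier (K s)) \<and> \<Phi> x = a"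
    and \<Phi>_add: "\<And>x y z. (\<And>s. x s \<in> carrier (K s)) \<Longrightarrow> (\<And>s. y s \<in> carrier (K s)) \<Longrightarrow>
          (\<And>s. z s \<in> carrier (K s)) \<Longrightarrow> (\<forall>\<^sub>F s in D. z s = x s \<oplus>\<^bsub>K s\<^esub> y s) \<Longrightarrow>
          \<Phi> z = \<Phi> x + \<Phi> y"
    and \<Phi>_mult: "\<And>x y z. (\<And>s. x s \<in> carrier (K s)) \<Longrightarrow> (\<And>s. y s \<in> carrier (K s)) \<Longrightarrow>
          (\<And>s. z s \<in> carrier (K s)) \<Longrightarrow> (\<forall>\<^sub>F s in D. z s = x s \<otimes>\<^bsub>K s\<^esub> y s) \<Longrightarrow>
          \<Phi> z = \<Phi> x * \<Phi> y"

lemma ultra_finite_field_coords: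
  fixes D :: "'s filter" and K :: "'s \<Rightarrow> 'b ring"
  assumes "ultra_finite_field D K TYPE('a::Fields.field)"
  obtains \<Phi> :: "('s \<Rightarrow> 'b) \<Rightarrow> 'a::Fields.field" where "ultraproduct_coords D K \<Phi>"
proof -
  define U where "U = ultraproduct D K"
  define L where "L = (ring_of_type_algebra :: 'a ring)"
  have uf: "ultrafilter D" "\<And>s. carrier (K s) \<noteq> {}"
    "\<forall>\<^sub>F s in D. Ring.field (K s) \<and> finite (carrier (K s))" "U \<simeq> L"
    using assms by (auto simp: ultra_finite_field_def U_def L_def)
  then obtain h where h: "h \<in> ring_hom U L" "bij_betw h (carrier U) (carrier L)"
    unfolding is_ring_iso_def ring_iso_def by blast
  have L: "carrier L = UNIV" "x \<oplus>\<^bsub>L\<^esub> y = x + y" "x \<otimes>\<^bsub>L\<^esub> y = x * y" for x y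
    by (simp_all add: L_def ring_of_type_algebra_def)
  define PI where "PI = (\<Pi> s\<in>UNIV. carrier (K s))"
  define cl where "cl x = ultra_rel D K `` {x}" for x
  have PI: "x \<in> PI \<longleftrightarrow> (\<forall>s. x s \<in> carrier (K s))" for x by (auto simp: PI_def)
  have cl: "cl x = {y \<in> PI. \<forall>\<^sub>F s in D. x s = y s}" if "x \<in> PI" for x
    using that by (auto simp: cl_def ultra_rel_def PI_def)
  have carU: "carrier U = cl ` PI"
    by (auto simp: U_def ultraproduct_def cl_def quotient_def PI_def)
  have cl_eq: "cl x = cl y \<longleftrightarrow> (\<forall>\<^sub>F s in D. x s = y s)" if xy: "x \<in> PI" "y \<in> PI" for x y
  proof
    assume "cl x = cl y"
    moreover have "y \<in> cl y" using xy by (simp add: cl)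
    ultimately have "y \<in> cl x" by simp
    thus "\<forall>\<^sub>F s in D. x s = y s" using xy by (simp add: cl)
  next
    assume *: "\<forall>\<^sub>F s in D. x s = y s"
    have "(\<forall>\<^sub>F s in D. x s = z s) \<longleftrightarrow> (\<forall>\<^sub>F s in D. y s = z s)" for z
      by (rule eventually_subst) (use * in \<open>auto elim!: eventually_mono\<close>)
    thus "cl x = cl y" using xy by (simp add: cl)
  qed
  have op: "{w \<in> PI. \<exists>f\<in>cl x. \<exists>g\<in>cl y. \<forall>\<^sub>F s in D. w s = p s (f s) (g s)} = cl z"
    if "x \<in> PI" "y \<in> PI" "z \<in> PI" and z: "\<forall>\<^sub>F s in D. z s = p s (x s) (y s)"
    for x y z :: "'s \<Rightarrow> 'b" and p
  proof (intro equalityI subsetI)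
    fix w assume "w \<in> {w \<in> PI. \<exists>f\<in>cl x. \<exists>g\<in>cl y. \<forall>\<^sub>F s in D. w s = p s (f s) (g s)}"
    then obtain f g where "f \<in> cl x" "g \<in> cl y" and w: "w \<in> PI"
      "\<forall>\<^sub>F s in D. w s = p s (f s) (g s)" by blast
    hence "\<forall>\<^sub>F s in D. x s = f s" "\<forall>\<^sub>F s in D. y s = g s" using that by (auto simp: cl)
    with w(2) z have "\<forall>\<^sub>F s in D. z s = w s" by eventually_elim simp
    thus "w \<in> cl z" using w(1) that by (simp add: cl)
  next
    fix w assume "w \<in> cl z"
    hence w: "w \<in> PI" "\<forall>\<^sub>F s in D. z s = w s" using that by (auto simp: cl)
    from w(2) z have "\<forall>\<^sub>F s in D. w s = p s (x s) (y s)" by eventually_elim simp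
    moreover have "x \<in> cl x" "y \<in> cl y" using that by (auto simp: cl)
    ultimately show "w \<in> {w \<in> PI. \<exists>f\<in>cl x. \<exists>g\<in>cl y. \<forall>\<^sub>F s in D. w s = p s (f s) (g s)}"
      using w(1) by blast
  qed
  have add: "cl x \<oplus>\<^bsub>U\<^esub> cl y = cl z"
    if "x \<in> PI" "y \<in> PI" "z \<in> PI" "\<forall>\<^sub>F s in D. z s = x s \<oplus>\<^bsub>K s\<^esub> y s" for x y z
    using op[of x y z "\<lambda>s a b. a \<oplus>\<^bsub>K s\<^esub> b"] that
    by (simp add: U_def ultraproduct_def flip: PI_def)
  have mult: "cl x \<otimes>\<^bsub>U\<^esub> cl y = cl z"
    if "x \<in> PI" "y \<in> PI" "z \<in> PI" "\<forall>\<^sub>F s in D. z s = x s \<otimes>\<^bsub>K s\<^esub> y s" for x y z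
    using op[of x y z "\<lambda>s a b. a \<otimes>\<^bsub>K s\<^esub> b"] that
    by (simp add: U_def ultraproduct_def flip: PI_def)
  show thesis
  proof (rule that[of "\<lambda>x. h (cl x)"], unfold_locales)
    show "ultrafilter D" "\<And>s. carrier (K s) \<noteq> {}" by fact+
    show "\<forall>\<^sub>F s in D. Ring.field (K s)" "\<forall>\<^sub>F s in D. finite (carrier (K s))"
      using uf(3) by (auto elim: eventually_mono)
    fix x y :: "'s \<Rightarrow> 'b"
    assume "\<And>s. x s \<in> carrier (K s)" "\<And>s. y s \<in> carrier (K s)"
    hence xy: "x \<in> PI" "y \<in> PI" by (auto simp: PI)
    hence xyU: "cl x \<in> carrier U" "cl y \<in> carrier U" by (auto simp: carU)
    have "h (cl x) = h (cl y) \<longleftrightarrow> cl x = cl y"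
      using h(2) xyU by (auto simp: bij_betw_def inj_on_def)
    thus "h (cl x) = h (cl y) \<longleftrightarrow> (\<forall>\<^sub>F s in D. x s = y s)" using cl_eq xy by simp
    fix z :: "'s \<Rightarrow> 'b"
    assume "\<And>s. z s \<in> carrier (K s)"
    hence z: "z \<in> PI" by (auto simp: PI)
    show "h (cl z) = h (cl x) + h (cl y)" if "\<forall>\<^sub>F s in D. z s = x s \<oplus>\<^bsub>K s\<^esub> y s"
      using add[OF xy z that] ring_hom_add[OF h(1) xyU] by (simp add: L)
    show "h (cl z) = h (cl x) * h (cl y)" if "\<forall>\<^sub>F s in D. z s = x s \<otimes>\<^bsub>K s\<^esub> y s"
      using mult[OF xy z that] ring_hom_mult[OF h(1) xyU] by (simp add: L)
  next
    fix a :: 'a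
    have "a \<in> h ` carrier U" using h(2) L by (auto simp: bij_betw_def)
    thus "\<exists>x. (\<forall>s. x s \<in> carrier (K s)) \<and> h (cl x) = a" by (fastforce simp: carU PI)
  qed
qed

context ultraproduct_coords
begin

text \<open>A function of \<open>I\<close>-indexed tuples is internal if it is induced by a family of functions on the factors.
Tuples are extensional functions on \<open>I\<close>, so that the tuples over a finite factor form a finite
set.\<close>

definition internal :: "'i set \<Rightarrow> (('i \<Rightarrow> 'a) \<Rightarrow> 'a) \<Rightarrow> bool" where
  "internal I f \<longleftrightarrow> (\<exists>f'. (\<forall>s. \<forall>u \<in> I \<rightarrow>\<^sub>E carrier (K s). f' s u \<in> carrier (K s)) \<and>
     (\<forall>W. (\<forall>i\<in>I. \<forall>s. W i s \<in> carrier (K s)) \<longrightarrow>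
        f (\<lambda>i\<in>I. \<Phi> (W i)) = \<Phi> (\<lambda>s. f' s (\<lambda>i\<in>I. W i s))))"

lemma internal_const: "internal I (\<lambda>_. a)"
proof -
  obtain x where "\<forall>s. x s \<in> carrier (K s)" "\<Phi> x = a" using \<Phi>_surj by blast
  thus ?thesis unfolding internal_def by (intro exI[of _ "\<lambda>s _. x s"]) auto
qed

lemma internal_proj: "i \<in> I \<Longrightarrow> internal I (\<lambda>a. a i)"
  unfolding internal_def by (intro exI[of _ "\<lambda>_ u. u i"]) auto

lemma internal_binop:
  assumes f: "internal I f" and g: "internal I g"
    and closed: "\<forall>\<^sub>F s in D. \<forall>x\<in>carrier (K s). \<forall>y\<in>carrier (K s). p s x y \<in> carrier (K s)"
    and \<Phi>_p: "\<And>x y z. (\<And>s. x s \<in> carrier (K s)) \<Longrightarrow> (\<And>s. y s \<in> carrier (K s)) \<Longrightarrow>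
          (\<And>s. z s \<in> carrier (K s)) \<Longrightarrow> (\<forall>\<^sub>F s in D. z s = p s (x s) (y s)) \<Longrightarrow>
          \<Phi> z = q (\<Phi> x) (\<Phi> y)"
  shows "internal I (\<lambda>a. q (f a) (g a))"
proof -
  obtain f' where f': "\<And>s u. u \<in> I \<rightarrow>\<^sub>E carrier (K s) \<Longrightarrow> f' s u \<in> carrier (K s)"
     "\<And>W. (\<forall>i\<in>I. \<forall>s. W i s \<in> carrier (K s)) \<Longrightarrow>
        f (\<lambda>i\<in>I. \<Phi> (W i)) = \<Phi> (\<lambda>s. f' s (\<lambda>i\<in>I. W i s))"
    using f unfolding internal_def by blast
  obtain g' where g': "\<And>s u. u \<in> I \<rightarrow>\<^sub>E carrier (K s) \<Longrightarrow> g' s u \<in> carrier (K s)"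
     "\<And>W. (\<forall>i\<in>I. \<forall>s. W i s \<in> carrier (K s)) \<Longrightarrow>
        g (\<lambda>i\<in>I. \<Phi> (W i)) = \<Phi> (\<lambda>s. g' s (\<lambda>i\<in>I. W i s))"
    using g unfolding internal_def by blast
  define k where "k s u = (let w = p s (f' s u) (g' s u) in
    if w \<in> carrier (K s) then w else SOME w. w \<in> carrier (K s))" for s u
  have k: "k s u \<in> carrier (K s)" for s u
    using nonempty[of s] by (auto simp: k_def Let_def some_in_eq)
  have "q (f (\<lambda>i\<in>I. \<Phi> (W i))) (g (\<lambda>i\<in>I. \<Phi> (W i))) = \<Phi> (\<lambda>s. k s (\<lambda>i\<in>I. W i s))"
    if W: "\<forall>i\<in>I. \<forall>s. W i s \<in> carrier (K s)" for W
  proof -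
    have u: "(\<lambda>i\<in>I. W i s) \<in> I \<rightarrow>\<^sub>E carrier (K s)" for s using W by auto
    have "\<forall>\<^sub>F s in D. k s (\<lambda>i\<in>I. W i s) = p s (f' s (\<lambda>i\<in>I. W i s)) (g' s (\<lambda>i\<in>I. W i s))"
      using closed by eventually_elim (use f'(1) g'(1) u in \<open>simp add: k_def\<close>)
    thus ?thesis
      unfolding f'(2)[OF W] g'(2)[OF W] using u f'(1) g'(1) k
      by (intro \<Phi>_p[symmetric]) auto
  qed
  thus ?thesis unfolding internal_def using k by (intro exI[of _ k]) blast
qed

lemma internal_add:
  assumes "internal I f" "internal I g"
  shows "internal I (\<lambda>a. f a + g a)"
proof (rule internal_binop[OF assms, where p = "\<lambda>s x y. x \<oplus>\<^bsub>K s\<^esub> y" and q = "(+)"])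
  show "\<forall>\<^sub>F s in D. \<forall>x\<in>carrier (K s). \<forall>y\<in>carrier (K s). x \<oplus>\<^bsub>K s\<^esub> y \<in> carrier (K s)"
    using ev_field by eventually_elim (auto simp: field.is_ring ring.ring_simprules(1))
qed (rule \<Phi>_add)

lemma internal_mult:
  assumes "internal I f" "internal I g"
  shows "internal I (\<lambda>a. f a * g a)"
proof (rule internal_binop[OF assms, where p = "\<lambda>s x y. x \<otimes>\<^bsub>K s\<^esub> y" and q = "(*)"])
  show "\<forall>\<^sub>F s in D. \<forall>x\<in>carrier (K s). \<forall>y\<in>carrier (K s). x \<otimes>\<^bsub>K s\<^esub> y \<in> carrier (K s)"
    using ev_field by eventually_elim (auto simp: field.is_ring ring.ring_simprules(5))
qed (rule \<Phi>_mult)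

lemma internal_sum: "(\<And>j. j \<in> J \<Longrightarrow> internal I (f j)) \<Longrightarrow> internal I (\<lambda>a. \<Sum>j\<in>J. f j a)"
  by (induction J rule: infinite_finite_induct) (auto intro: internal_const internal_add)

lemma eventually_ex_choice:
  assumes "\<not> (\<forall>\<^sub>F s in D. \<forall>u. P s u)"
  shows "\<exists>u. \<forall>\<^sub>F s in D. \<not> P s (u s)"
proof -
  have "\<forall>\<^sub>F s in D. \<not> (\<forall>u. P s u)" using ultra assms by (auto simp: ultrafilter_def)
  hence "\<forall>\<^sub>F s in D. \<not> P s (SOME u. \<not> P s u)"
    by eventually_elim (metis (mono_tags, lifting) someI)
  thus ?thesis by (rule exI[of _ "\<lambda>s. SOME u. \<not> P s u"])
qed

text \<open>An internal map from the tuples over a finite index set to themselves that is surjective is also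
injective, because for almost all \<open>s\<close> it is induced by a surjective map from a finite set to itself.
Apart from closure of internal functions under polynomial operations, this is the only property of
ultraproducts of finite fields that enters the proof.\<close>

theorem internal_surj_imp_inj:
  assumes I: "finite I" and \<phi>: "\<And>i. i \<in> I \<Longrightarrow> internal I (\<phi> i)"
    and surj: "\<And>b. \<exists>a \<in> I \<rightarrow>\<^sub>E UNIV. \<forall>i\<in>I. \<phi> i a = b i"
    and a: "a \<in> I \<rightarrow>\<^sub>E UNIV" "a' \<in> I \<rightarrow>\<^sub>E UNIV" and eq: "\<And>i. i \<in> I \<Longrightarrow> \<phi> i a = \<phi> i a'"
  shows "a = a'"
proof -
  have "\<forall>i\<in>I. \<exists>f'. (\<forall>s. \<forall>u \<in> I \<rightarrow>\<^sub>E carrier (K s). f' s u \<in> carrier (K s)) \<and>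
     (\<forall>W. (\<forall>i\<in>I. \<forall>s. W i s \<in> carrier (K s)) \<longrightarrow>
        \<phi> i (\<lambda>i\<in>I. \<Phi> (W i)) = \<Phi> (\<lambda>s. f' s (\<lambda>i\<in>I. W i s)))"
    using \<phi> unfolding internal_def by blast
  from bchoice[OF this] obtain \<phi>' where *: "\<forall>i\<in>I.
     (\<forall>s. \<forall>u \<in> I \<rightarrow>\<^sub>E carrier (K s). \<phi>' i s u \<in> carrier (K s)) \<and>
     (\<forall>W. (\<forall>i\<in>I. \<forall>s. W i s \<in> carrier (K s)) \<longrightarrow>
        \<phi> i (\<lambda>i\<in>I. \<Phi> (W i)) = \<Phi> (\<lambda>s. \<phi>' i s (\<lambda>i\<in>I. W i s)))" ..
  have \<phi>': "\<And>i s u. i \<in> I \<Longrightarrow> u \<in> I \<rightarrow>\<^sub>E carrier (K s) \<Longrightarrow> \<phi>' i s u \<in> carrier (K s)"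
     "\<And>i W. i \<in> I \<Longrightarrow> (\<forall>i\<in>I. \<forall>s. W i s \<in> carrier (K s)) \<Longrightarrow>
        \<phi> i (\<lambda>i\<in>I. \<Phi> (W i)) = \<Phi> (\<lambda>s. \<phi>' i s (\<lambda>i\<in>I. W i s))"
    using * by blast+
  define T where "T s u = (\<lambda>i\<in>I. \<phi>' i s u)" for s u
  define V where "V s = (I \<rightarrow>\<^sub>E carrier (K s))" for s
  have lift: "\<exists>W. (\<forall>i\<in>I. \<forall>s. W i s \<in> carrier (K s)) \<and> (\<lambda>i\<in>I. \<Phi> (W i)) = c"
    if c: "c \<in> I \<rightarrow>\<^sub>E UNIV" for c
  proof -
    obtain W where "\<forall>i. (\<forall>s. W i s \<in> carrier (K s)) \<and> \<Phi> (W i) = c i"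
      using choice[of "\<lambda>i x. (\<forall>s. x s \<in> carrier (K s)) \<and> \<Phi> x = c i"] \<Phi>_surj by blast
    thus ?thesis using c by (intro exI[of _ W]) (auto simp: PiE_def extensional_def fun_eq_iff)
  qed
  have T: "\<forall>\<^sub>F s in D. \<forall>i\<in>I. \<phi>' i s (\<lambda>i\<in>I. W i s) = Y i s"
    if W: "\<forall>i\<in>I. \<forall>s. W i s \<in> carrier (K s)" and Y: "\<forall>i\<in>I. \<forall>s. Y i s \<in> carrier (K s)"
      and XY: "\<And>i. i \<in> I \<Longrightarrow> \<phi> i (\<lambda>i\<in>I. \<Phi> (W i)) = \<Phi> (Y i)" for W Y
  proof (intro eventually_ball_finite I ballI)
    fix i assume i: "i \<in> I"
    have "\<phi>' i s (\<lambda>i\<in>I. W i s) \<in> carrier (K s)" for s using W by (intro \<phi>'(1) i) auto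
    thus "\<forall>\<^sub>F s in D. \<phi>' i s (\<lambda>i\<in>I. W i s) = Y i s"
      using \<phi>'(2)[OF i W] XY[OF i] Y i
        \<Phi>_eq_iff[of "\<lambda>s. \<phi>' i s (\<lambda>i\<in>I. W i s)" "Y i"] by simp
  qed
  have surj_s: "\<forall>\<^sub>F s in D. \<forall>y. y \<in> V s \<longrightarrow> (\<exists>u\<in>V s. T s u = y)"
  proof (rule ccontr)
    assume "\<not> ?thesis"
    then obtain y where y: "\<forall>\<^sub>F s in D. \<not> (y s \<in> V s \<longrightarrow> (\<exists>u\<in>V s. T s u = y s))"
      using eventually_ex_choice[of "\<lambda>s y. y \<in> V s \<longrightarrow> (\<exists>u\<in>V s. T s u = y)"] by blast
    define Y where "Y i s = (if y s \<in> V s then y s i else SOME w. w \<in> carrier (K s))" for i s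
    have Y: "\<forall>i\<in>I. \<forall>s. Y i s \<in> carrier (K s)"
      using nonempty by (auto simp: Y_def V_def some_in_eq)
    obtain c where c: "c \<in> I \<rightarrow>\<^sub>E UNIV" "\<And>i. i \<in> I \<Longrightarrow> \<phi> i c = \<Phi> (Y i)"
      using surj[of "\<lambda>i. \<Phi> (Y i)"] by blast
    obtain W where W: "\<forall>i\<in>I. \<forall>s. W i s \<in> carrier (K s)" "(\<lambda>i\<in>I. \<Phi> (W i)) = c"
      using lift[OF c(1)] by blast
    have "\<forall>\<^sub>F s in D. \<forall>i\<in>I. \<phi>' i s (\<lambda>i\<in>I. W i s) = Y i s"
      using T[OF W(1) Y] c(2) W(2) by simp
    with y have "\<forall>\<^sub>F s in D. False"
    proof eventually_elim
      case (elim s)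
      have "(\<lambda>i\<in>I. W i s) \<in> V s" using W(1) by (auto simp: V_def)
      moreover have "T s (\<lambda>i\<in>I. W i s) = y s"
        using elim by (auto simp: T_def V_def Y_def fun_eq_iff PiE_def extensional_def)
      ultimately show ?case using elim by blast
    qed
    thus False using ultra by (simp add: ultrafilter_def trivial_limit_def)
  qed
  obtain W where W: "\<forall>i\<in>I. \<forall>s. W i s \<in> carrier (K s)" "(\<lambda>i\<in>I. \<Phi> (W i)) = a"
    using lift[OF a(1)] by blast
  obtain W' where W': "\<forall>i\<in>I. \<forall>s. W' i s \<in> carrier (K s)" "(\<lambda>i\<in>I. \<Phi> (W' i)) = a'"
    using lift[OF a(2)] by blast
  define Y where "Y i s = \<phi>' i s (\<lambda>i\<in>I. W' i s)" for i s
  have Y: "\<forall>i\<in>I. \<forall>s. Y i s \<in> carrier (K s)" using W' by (auto simp: Y_def intro!: \<phi>'(1))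
  have "\<phi> i a = \<Phi> (Y i)" if "i \<in> I" for i
  proof -
    have "Y i = (\<lambda>s. \<phi>' i s (\<lambda>i\<in>I. W' i s))" by (simp add: Y_def fun_eq_iff)
    thus ?thesis using eq[OF that] \<phi>'(2)[OF that W'(1)] W'(2) by simp
  qed
  hence "\<forall>\<^sub>F s in D. \<forall>i\<in>I. \<phi>' i s (\<lambda>i\<in>I. W i s) = Y i s"
    using T[OF W(1) Y] W(2) by simp
  with surj_s ev_finite have "\<forall>\<^sub>F s in D. (\<lambda>i\<in>I. W i s) = (\<lambda>i\<in>I. W' i s)"
  proof eventually_elim
    case (elim s)
    have fin: "finite (V s)" unfolding V_def using elim I by (intro finite_PiE) auto
    have "V s \<subseteq> T s ` V s" using elim by blast
    hence "inj_on (T s) (V s)" by (intro eq_card_imp_inj_on fin)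
       (meson card_image_le card_mono fin finite_imageI le_antisym)
    moreover have "T s (\<lambda>i\<in>I. W i s) = T s (\<lambda>i\<in>I. W' i s)"
      using elim by (auto simp: T_def Y_def fun_eq_iff)
    moreover have "(\<lambda>i\<in>I. W i s) \<in> V s" "(\<lambda>i\<in>I. W' i s) \<in> V s" using W W' by (auto simp: V_def)
    ultimately show ?case by (auto dest: inj_onD)
  qed
  hence ev: "\<forall>\<^sub>F s in D. W i s = W' i s" if "i \<in> I" for i
    by (rule eventually_mono) (use that in \<open>auto dest: fun_cong[where x = i]\<close>)
  have "\<Phi> (W i) = \<Phi> (W' i)" if "i \<in> I" for i
    using ev[OF that] W W' that \<Phi>_eq_iff[of "W i" "W' i"] by simp
  hence "(\<lambda>i\<in>I. \<Phi> (W i)) = (\<lambda>i\<in>I. \<Phi> (W' i))" by (intro restrict_ext) auto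
  thus ?thesis using W W' by simp
qed

end

section \<open>Finite subextensions of the algebraic closure\<close>

text \<open>The embedding of the polynomial ring into the polynomial ring over the algebraic closure.\<close>

definition lift_poly :: "'a::Fields.field poly \<Rightarrow> 'a alg_closure poly" where
  "lift_poly = map_poly to_ac"

lemma coeff_lift_poly [simp]: "Polynomial.coeff (lift_poly p) i = to_ac (Polynomial.coeff p i)"
  by (simp add: lift_poly_def coeff_map_poly)

lemma lift_poly_mult: "lift_poly (p * q) = lift_poly p * lift_poly q"
  by (rule poly_eqI) (simp add: coeff_mult to_ac_sum)

lemma lift_poly_diff: "lift_poly (p - q) = lift_poly p - lift_poly q"
  by (rule poly_eqI) simp

lemma lift_poly_smult: "lift_poly (smult c p) = smult (to_ac c) (lift_poly p)"
  by (rule poly_eqI) simp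

lemma lift_poly_1: "lift_poly 1 = 1"
  by (simp add: lift_poly_def)

lemma lift_poly_power: "lift_poly (p ^ n) = lift_poly p ^ n"
  by (induction n) (simp_all add: lift_poly_1 lift_poly_mult)

lemma lift_poly_eq_iff [simp]: "lift_poly p = lift_poly q \<longleftrightarrow> p = q"
  by (simp add: poly_eq_iff)

lemma lift_poly_eq_0_iff [simp]: "lift_poly p = 0 \<longleftrightarrow> p = 0"
  by (simp add: poly_eq_iff)

lemma degree_lift_poly [simp]: "Polynomial.degree (lift_poly p) = Polynomial.degree p"
  by (simp add: lift_poly_def degree_map_poly)

lemma lift_poly_pCons [simp]: "lift_poly (pCons a p) = pCons (to_ac a) (lift_poly p)"
  by (simp add: lift_poly_def map_poly_pCons)

lemma polys_over_range_to_ac: "polys_over (range to_ac) = range lift_poly"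
proof (intro equalityI subsetI)
  fix p :: "'a alg_closure poly" assume p: "p \<in> polys_over (range to_ac)"
  have "p = lift_poly (map_poly of_ac p)"
    using p by (intro poly_eqI) (simp add: coeff_map_poly polys_overD to_ac_of_ac)
  thus "p \<in> range lift_poly" by blast
qed (auto simp: polys_over_def)

interpretation ac: vector_space "\<lambda>(a :: 'a::Fields.field) (x :: 'a alg_closure). to_ac a * x"
  by unfold_locales (simp_all add: algebra_simps)

text \<open>\<open>B\<close> is a finite set, not necessarily independent, whose span over the base field is a
subalgebra of the algebraic closure. The span is then even a subfield, because every element of the
closure is algebraic.\<close>

definition spans_subalgebra :: "'a::Fields.field alg_closure set \<Rightarrow> bool" where
  "spans_subalgebra B \<longleftrightarrow> finite B \<and> 1 \<in> ac.span B \<and>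
     (\<forall>x\<in>ac.span B. \<forall>y\<in>ac.span B. x * y \<in> ac.span B)"

lemma span_mult_closed:
  fixes B :: "'a::Fields.field alg_closure set"
  assumes "\<And>b c. b \<in> B \<Longrightarrow> c \<in> C \<Longrightarrow> b * c \<in> ac.span A"
    and "x \<in> ac.span B" "y \<in> ac.span C"
  shows "x * y \<in> ac.span A"
proof -
  have *: "b * y \<in> ac.span A" if b: "b \<in> B" for b
    using assms(3)
  proof (induction rule: ac.span_induct_alt)
    case base
    show ?case by (simp add: ac.span_zero)
  next
    case (step c z w)
    have "b * (to_ac c * z + w) = to_ac c * (b * z) + b * w" by (simp add: algebra_simps)
    thus ?case using assms(1)[OF b step(1)] step(2) by (simp add: ac.span_add ac.span_scale)
  qed
  show ?thesis using assms(2)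
  proof (induction rule: ac.span_induct_alt)
    case base
    show ?case by (simp add: ac.span_zero)
  next
    case (step c z w)
    have "(to_ac c * z + w) * y = to_ac c * (z * y) + w * y" by (simp add: algebra_simps)
    thus ?case using *[OF step(1)] step(2) by (simp add: ac.span_add ac.span_scale)
  qed
qed

text \<open>The products \<open>b * \<theta> ^ i\<close> with \<open>b\<close> in \<open>B\<close> and \<open>i\<close> at most the degree of an equation of
\<open>\<theta>\<close> over the base field span the subalgebra generated by \<open>\<theta>\<close> over the span of \<open>B\<close>.\<close>

lemma adjoin_element:
  fixes \<theta> :: "'a::Fields.field alg_closure"
  assumes B: "spans_subalgebra B"
  shows "\<exists>B'. spans_subalgebra B' \<and> ac.span B \<subseteq> ac.span B' \<and> \<theta> \<in> ac.span B'"
proof -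
  obtain p where p: "p \<noteq> 0" "poly (lift_poly p) \<theta> = 0"
    using alg_closure_algebraic[of \<theta>] by (auto simp: lift_poly_def)
  define d where "d = Polynomial.degree p"
  define B' where "B' = (\<lambda>(b, i). b * \<theta> ^ i) ` (B \<times> {..d})"
  have fin: "finite B'" using B by (auto simp: B'_def spans_subalgebra_def)
  have BB': "B \<subseteq> B'"
  proof
    fix b assume "b \<in> B"
    thus "b \<in> B'" unfolding B'_def by (intro image_eqI[of _ _ "(b, 0)"]) auto
  qed
  have span_i: "x * \<theta> ^ i \<in> ac.span B'" if "x \<in> ac.span B" "i \<le> d" for x i
  proof (rule span_mult_closed[of B "{\<theta> ^ i}"])
    show "b * c \<in> ac.span B'" if "b \<in> B" "c \<in> {\<theta> ^ i}" for b c
      using that \<open>i \<le> d\<close> by (intro ac.span_base) (auto simp: B'_def)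
  qed (use that in \<open>auto intro: ac.span_base\<close>)
  have rel: "\<theta> ^ d = (\<Sum>i<d. to_ac (- Polynomial.coeff p i / lead_coeff p) * \<theta> ^ i)"
  proof -
    have "0 = (\<Sum>i\<le>d. to_ac (Polynomial.coeff p i) * \<theta> ^ i)"
      using p(2) by (simp add: poly_altdef d_def)
    also have "\<dots> = (\<Sum>i<d. to_ac (Polynomial.coeff p i) * \<theta> ^ i) + to_ac (lead_coeff p) * \<theta> ^ d"
      by (simp add: d_def flip: lessThan_Suc_atMost)
    finally have "\<theta> ^ d = - (\<Sum>i<d. to_ac (Polynomial.coeff p i) * \<theta> ^ i) / to_ac (lead_coeff p)"
      using p(1) by (simp add: field_simps eq_neg_iff_add_eq_0)
    also have "\<dots> = (\<Sum>i<d. to_ac (- Polynomial.coeff p i / lead_coeff p) * \<theta> ^ i)"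
      by (simp add: sum_negf sum_divide_distrib)
    finally show ?thesis .
  qed
  have pow: "x * \<theta> ^ k \<in> ac.span B'" if x: "x \<in> ac.span B" for x k
  proof (induction k rule: less_induct)
    case (less k)
    show ?case
    proof (cases "k \<le> d")
      case True
      thus ?thesis using span_i x by blast
    next
      case False
      hence "x * \<theta> ^ k = x * (\<theta> ^ (k - d) * \<theta> ^ d)" by (simp flip: power_add)
      also have "\<dots> = (\<Sum>i<d. to_ac (- Polynomial.coeff p i / lead_coeff p) * (x * \<theta> ^ (k - d + i)))"
        unfolding rel by (simp add: sum_distrib_left power_add mult_ac)
      also have "\<dots> \<in> ac.span B'"
        using False by (intro ac.span_sum ac.span_scale less) auto
      finally show ?thesis .
    qed
  qed
  have B1: "1 \<in> ac.span B" using B by (simp add: spans_subalgebra_def)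
  have sub: "ac.span B \<subseteq> ac.span B'" by (rule ac.span_mono[OF BB'])
  have "x * y \<in> ac.span B'" if "x \<in> ac.span B'" "y \<in> ac.span B'" for x y
  proof (rule span_mult_closed[OF _ that])
    fix b c assume "b \<in> B'" "c \<in> B'"
    then obtain b0 c0 i j where bc: "b0 \<in> B" "c0 \<in> B" "b = b0 * \<theta> ^ i" "c = c0 * \<theta> ^ j"
      by (auto simp: B'_def)
    have "b0 * c0 \<in> ac.span B" using B bc by (auto simp: spans_subalgebra_def ac.span_base)
    from pow[OF this, of "i + j"] show "b * c \<in> ac.span B'" by (simp add: bc power_add mult_ac)
  qed
  moreover have "\<theta> \<in> ac.span B'" using pow[OF B1, of 1] by simp
  ultimately show ?thesis using fin B1 sub by (auto simp: spans_subalgebra_def)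
qed

lemma exists_spanning_set_subalgebra:
  fixes S :: "'a::Fields.field alg_closure set"
  assumes "finite S"
  shows "\<exists>B. spans_subalgebra B \<and> S \<subseteq> ac.span B"
  using assms
proof (induction S rule: finite_induct)
  case empty
  have "x * y \<in> ac.span {1}" if "x \<in> ac.span {1}" "y \<in> ac.span {1}" for x y :: "'a alg_closure"
    by (rule span_mult_closed[OF _ that]) (simp add: ac.span_base)
  thus ?case by (intro exI[of _ "{1}"]) (auto simp: spans_subalgebra_def ac.span_base)
next
  case (insert \<theta> S)
  then obtain B where B: "spans_subalgebra B" "S \<subseteq> ac.span B" by blast
  with adjoin_element[OF B(1), of \<theta>] show ?case by blast
qed

lemma range_to_ac_subset_span: "spans_subalgebra B \<Longrightarrow> range to_ac \<subseteq> ac.span B"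
  using ac.span_scale[of 1 B] by (auto simp: spans_subalgebra_def)

lemma subfield_set_span:
  fixes B :: "'a::Fields.field alg_closure set"
  assumes B: "spans_subalgebra B"
  shows "subfield_set (ac.span B)"
proof
  show "0 \<in> ac.span B" "1 \<in> ac.span B" using B by (auto simp: spans_subalgebra_def ac.span_zero)
  fix x assume x: "x \<in> ac.span B"
  show "- x \<in> ac.span B" using x by (rule ac.span_neg)
  show "inverse x \<in> ac.span B"
  proof (cases "x = 0")
    case False
    have "p \<noteq> 0 \<Longrightarrow> poly (lift_poly p) x = 0 \<Longrightarrow> inverse x \<in> ac.span B" for p
    proof (induction p)
      case (pCons a q)
      show ?case
      proof (cases "a = 0")
        case True
        hence "poly (lift_poly q) x = 0" "q \<noteq> 0" using pCons.prems False by auto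
        thus ?thesis using pCons.IH by blast
      next
        case a: False
        have "poly (lift_poly q) x \<in> ac.span B" for q
        proof (induction q)
          case (pCons a q)
          have "to_ac a + x * poly (lift_poly q) x \<in> ac.span B"
            using pCons x B range_to_ac_subset_span[OF B]
            by (intro ac.span_add) (auto simp: spans_subalgebra_def)
          thus ?case by simp
        qed (simp add: ac.span_zero lift_poly_def)
        hence "to_ac (- inverse a) * poly (lift_poly q) x \<in> ac.span B" by (rule ac.span_scale)
        moreover have "inverse x = to_ac (- inverse a) * poly (lift_poly q) x"
          using pCons.prems(2) a False by (simp add: field_simps eq_neg_iff_add_eq_0)
        ultimately show ?thesis by simp
      qed
    qed simp
    thus ?thesis using alg_closure_algebraic[of x] by (metis lift_poly_def)
  qed (simp add: ac.span_zero)
  fix y assume y: "y \<in> ac.span B"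
  show "x + y \<in> ac.span B" using x y by (rule ac.span_add)
  show "x * y \<in> ac.span B" using B x y by (simp add: spans_subalgebra_def)
qed

lemma subfield_set_range_to_ac: "subfield_set (range to_ac)"
proof
  show "0 \<in> range to_ac" "1 \<in> range to_ac" by (metis rangeI to_ac_0, metis rangeI to_ac_1)
qed (auto simp flip: to_ac_add to_ac_mult to_ac_minus to_ac_inverse)

text \<open>On a finite extension of the base field, the \<open>m\<close>-th power map is injective if it is surjective: in
coordinates with respect to a basis it is given by polynomials over the base field and hence is
internal.\<close>

theorem (in ultraproduct_coords) power_surj_imp_inj:
  assumes B0: "spans_subalgebra B0" and surj: "\<forall>c\<in>ac.span B0. \<exists>z\<in>ac.span B0. c = z ^ m"
  shows "inj_on (\<lambda>z. z ^ m) (ac.span (B0 :: 'a alg_closure set))"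
proof -
  obtain B where B: "B \<subseteq> B0" "ac.independent B" "B0 \<subseteq> ac.span B"
    using ac.maximal_independent_subset[of B0] by blast
  have fin: "finite B" using B B0 finite_subset by (auto simp: spans_subalgebra_def)
  have span: "ac.span B0 = ac.span B"
    using ac.span_mono[OF B(1)] ac.span_minimal[OF B(3) ac.subspace_span] by (rule equalityI[rotated])
  define E where "E = ac.span B"
  have E1: "1 \<in> E" and Em: "\<And>x y. x \<in> E \<Longrightarrow> y \<in> E \<Longrightarrow> x * y \<in> E"
    using B0 by (auto simp: E_def spans_subalgebra_def span)
  have Ep: "x ^ k \<in> E" if "x \<in> E" for x k
    by (induction k) (auto intro: E1 Em that)
  define rep where "rep = ac.representation B"
  define e where "e a = (\<Sum>b\<in>B. to_ac (a b) * b)" for a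
  have eE: "e a \<in> E" for a
    unfolding e_def E_def by (intro ac.span_sum ac.span_scale ac.span_base)
  have e_rep: "e (rep x) = x" if "x \<in> E" for x
    unfolding e_def rep_def using that B fin
    by (intro ac.sum_representation_eq) (auto simp: E_def)
  have rep_sum: "rep (\<Sum>j\<in>J. f j) b = (\<Sum>j\<in>J. rep (f j) b)"
    if "\<And>j. j \<in> J \<Longrightarrow> f j \<in> ac.span B" for f b and J :: "'a alg_closure set"
    unfolding rep_def using ac.representation_sum[OF B(2), of J f] that by simp
  have rep_scale: "rep (to_ac r * x) b = r * rep x b" if "x \<in> ac.span B" for r x b
    unfolding rep_def using ac.representation_scale[OF B(2) that] by simp
  have rep_basis: "rep c b = (if b = c then 1 else 0)" if "c \<in> B" for b c
    unfolding rep_def using ac.representation_basis[OF B(2) that] by simp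
  have rep_e: "rep (e a) b = a b" if "b \<in> B" for a b
  proof -
    have "rep (e a) b = (\<Sum>c\<in>B. rep (to_ac (a c) * c) b)"
      unfolding e_def by (intro rep_sum ac.span_scale ac.span_base)
    also have "\<dots> = (\<Sum>c\<in>B. if b = c then a c else 0)"
      by (intro sum.cong refl) (auto simp: rep_scale ac.span_base rep_basis)
    also have "\<dots> = a b" using fin that by simp
    finally show ?thesis .
  qed
  have int: "internal B (\<lambda>a. rep (e a ^ k) b)" for k b
  proof (induction k arbitrary: b)
    case 0
    show ?case by (simp add: internal_const)
  next
    case (Suc k)
    have "rep (e a ^ Suc k) b = (\<Sum>c\<in>B. \<Sum>d\<in>B. a c * (rep (e a ^ k) d * rep (c * d) b))" for a
    proof -
      have "e a ^ Suc k = e a * e (rep (e a ^ k))" using e_rep[OF Ep[OF eE]] by simp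
      also have "\<dots> = (\<Sum>c\<in>B. \<Sum>d\<in>B. to_ac (a c) * (to_ac (rep (e a ^ k) d) * (c * d)))"
        unfolding e_def sum_product by (intro sum.cong refl) (simp add: mult_ac)
      finally have eq: "e a ^ Suc k =
        (\<Sum>c\<in>B. \<Sum>d\<in>B. to_ac (a c) * (to_ac (rep (e a ^ k) d) * (c * d)))" .
      have cd: "c * d \<in> ac.span B" if "c \<in> B" "d \<in> B" for c d
        using that Em by (auto simp: E_def ac.span_base)
      have cds: "to_ac r * (c * d) \<in> ac.span B" "to_ac r' * (to_ac r * (c * d)) \<in> ac.span B"
        if "c \<in> B" "d \<in> B" for c d r r'
        by (rule ac.span_scale[OF cd[OF that]])
          (rule ac.span_scale[OF ac.span_scale[OF cd[OF that]]])
      have "rep (e a ^ Suc k) b =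
        (\<Sum>c\<in>B. rep (\<Sum>d\<in>B. to_ac (a c) * (to_ac (rep (e a ^ k) d) * (c * d))) b)"
        unfolding eq by (intro rep_sum ac.span_sum cds)
      also have "\<dots> = (\<Sum>c\<in>B. \<Sum>d\<in>B. rep (to_ac (a c) * (to_ac (rep (e a ^ k) d) * (c * d))) b)"
        by (intro sum.cong refl rep_sum cds)
      also have "\<dots> = (\<Sum>c\<in>B. \<Sum>d\<in>B. a c * (rep (e a ^ k) d * rep (c * d) b))"
        by (intro sum.cong refl) (simp only: rep_scale cds cd)
      finally show ?thesis .
    qed
    thus ?case by (simp only:) (intro internal_sum internal_mult internal_proj Suc internal_const)
  qed
  show ?thesis
  proof (rule inj_onI)
    fix x y assume xy: "x \<in> ac.span B0" "y \<in> ac.span B0" "x ^ m = y ^ m"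
    hence xyE: "x \<in> E" "y \<in> E" by (auto simp: E_def span)
    have er: "e (restrict a B) = e a" for a by (auto simp: e_def intro!: sum.cong)
    have "restrict (rep x) B = restrict (rep y) B"
    proof (rule internal_surj_imp_inj[of B "\<lambda>b a. rep (e a ^ m) b"])
      fix c :: "'a alg_closure \<Rightarrow> 'a"
      obtain z where z: "z \<in> E" "e c = z ^ m" using surj eE[of c] by (auto simp: E_def span)
      show "\<exists>a\<in>B \<rightarrow>\<^sub>E UNIV. \<forall>b\<in>B. rep (e a ^ m) b = c b"
        by (intro bexI[of _ "restrict (rep z) B"])
           (auto simp: er e_rep[OF z(1)] rep_e simp flip: z(2))
    qed (auto simp: fin int er e_rep xyE xy)
    hence "e (rep x) = e (rep y)" by (metis er)
    thus "x = y" by (simp add: e_rep xyE)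
  qed
qed

section \<open>Powers in the completion\<close>

lemma exists_inverse_mod_irreducible:
  fixes P b :: "'a::Fields.field poly"
  assumes P: "Factorial_Ring.irreducible P" and b: "\<not> P dvd b"
  shows "\<exists>b'. P dvd b * b' - 1"
proof -
  have P0: "P \<noteq> 0" "\<not> is_unit P" using P by (auto simp: Factorial_Ring.irreducible_def)
  have small: "\<exists>b'. P dvd b * b' - 1"
    if "b \<noteq> 0" "Polynomial.degree b < Polynomial.degree P" for b
    using that
  proof (induction "Polynomial.degree b" arbitrary: b rule: less_induct)
    case (less b)
    show ?case
    proof (cases "Polynomial.degree b = 0")
      case True
      then obtain c where c: "b = [:c:]" by (metis degree_eq_zeroE)
      with less.prems show ?thesis by (intro exI[of _ "[:inverse c:]"]) (simp flip: one_pCons)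
    next
      case False
      define r where "r = P mod b"
      have "r \<noteq> 0"
      proof
        assume "r = 0"
        hence "b dvd P" by (simp add: r_def dvd_eq_mod_eq_0)
        moreover have "\<not> is_unit b" using False less.prems by (simp add: is_unit_iff_degree)
        ultimately have "P dvd b" using P by (meson irreducibleD')
        thus False using less.prems dvd_imp_degree_le[of P b] by simp
      qed
      moreover have "Polynomial.degree r < Polynomial.degree b"
        using \<open>r \<noteq> 0\<close> less.prems unfolding r_def by (intro degree_mod_less')
      ultimately obtain r' where r': "P dvd r * r' - 1" using less.hyps less.prems by fastforce
      have r: "r = P - P div b * b" by (simp add: r_def minus_div_mult_eq_mod)
      have "b * (- (P div b) * r') - 1 = ((P - P div b * b) * r' - 1) - P * r'"
        by (simp only: algebra_simps mult_minus_left mult_minus_right) simp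
      hence "b * (- (P div b) * r') - 1 = (r * r' - 1) - P * r'" by (simp only: r)
      hence "P dvd b * (- (P div b) * r') - 1" using r' by (metis dvd_diff dvd_triv_left)
      thus ?thesis by blast
    qed
  qed
  have "b mod P \<noteq> 0" using b by (simp add: dvd_eq_mod_eq_0)
  with small[of "b mod P"] obtain b' where b': "P dvd (b mod P) * b' - 1"
    using degree_mod_less'[OF P0(1)] by blast
  have "b * b' - 1 = ((b mod P) * b' - 1) + P * (b div P * b')"
  proof -
    have "b * b' = (b div P * P + b mod P) * b'" by simp
    also have "\<dots> = (b mod P) * b' + P * (b div P * b')"
      by (simp only: distrib_right distrib_left mult_ac add_ac)
    finally show ?thesis by simp
  qed
  thus ?thesis using b' by (metis dvd_add dvd_triv_left)
qed

text \<open>\<open>f\<close> may be divisible by \<open>P\<close> or zero, which makes sums and products of such elements easy to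
bound.\<close>

lemma P_val_ge_iff:
  fixes P :: "'a::Fields.field poly"
  assumes P: "Factorial_Ring.irreducible P"
  shows "Fin N \<le> P_val P x \<longleftrightarrow>
    (\<exists>f g. \<not> P dvd g \<and> x = to_fract P powi N * (to_fract f / to_fract g))"
proof
  assume ge: "Fin N \<le> P_val P x"
  show "\<exists>f g. \<not> P dvd g \<and> x = to_fract P powi N * (to_fract f / to_fract g)"
  proof (cases "x = 0")
    case True
    moreover have "\<not> P dvd 1" using P by (auto simp: Factorial_Ring.irreducible_def)
    ultimately show ?thesis by (intro exI[of _ 0] exI[of _ 1]) auto
  next
    case False
    obtain k f g where x: "f \<noteq> 0" "g \<noteq> 0" "\<not> P dvd f" "\<not> P dvd g"
      "x = to_fract P powi k * (to_fract f / to_fract g)" using P_val_cases[OF P False] by blast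
    hence "N \<le> k" using ge P_val_eqI[OF P x(1-4), of k] by simp
    moreover have "to_fract P \<noteq> 0" using P by auto
    ultimately have "to_fract P powi k = to_fract P powi N * to_fract (P ^ nat (k - N))"
      by (simp add: to_fract_power flip: power_int_of_nat power_int_add)
    hence "x = to_fract P powi N * (to_fract (P ^ nat (k - N) * f) / to_fract g)"
      using x(5) by (simp add: to_fract_mult)
    thus ?thesis using x(4) by blast
  qed
next
  assume "\<exists>f g. \<not> P dvd g \<and> x = to_fract P powi N * (to_fract f / to_fract g)"
  then obtain f g where x: "\<not> P dvd g" "x = to_fract P powi N * (to_fract f / to_fract g)" by blast
  show "Fin N \<le> P_val P x"
  proof (cases "f = 0")
    case True
    thus ?thesis using x by (simp add: P_val_def)
  next
    case False
    then obtain i f' where f': "f = P ^ i * f'" "\<not> P dvd f'"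
      using irreducible_poly_decompose[OF P] by blast
    have nz: "f' \<noteq> 0" "g \<noteq> 0" "to_fract P \<noteq> 0" using f' x P by auto
    have "to_fract P powi N * to_fract P ^ i = to_fract P powi (N + int i)"
      using nz(3) by (simp add: power_int_add)
    hence "x = to_fract P powi (N + int i) * (to_fract f' / to_fract g)"
      unfolding x(2) f'(1) by (simp add: to_fract_mult to_fract_power flip: mult.assoc)
    thus ?thesis using P_val_eqI[OF P nz(1,2) f'(2) x(1)] by simp
  qed
qed

lemma P_val_ge_add:
  fixes P :: "'a::Fields.field poly"
  assumes P: "Factorial_Ring.irreducible P" and "Fin N \<le> P_val P x" "Fin N \<le> P_val P y"
  shows "Fin N \<le> P_val P (x + y)"
proof -
  obtain f g f' g' where g: "\<not> P dvd g" "\<not> P dvd g'"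
    and x: "x = to_fract P powi N * (to_fract f / to_fract g)"
    and y: "y = to_fract P powi N * (to_fract f' / to_fract g')"
    using assms by (auto simp: P_val_ge_iff[OF P])
  have nz: "to_fract g \<noteq> 0" "to_fract g' \<noteq> 0" using g by auto
  have "x + y = to_fract P powi N * (to_fract (f * g' + f' * g) / to_fract (g * g'))"
    unfolding x y using nz by (simp add: to_fract_mult to_fract_add field_simps)
  moreover have "\<not> P dvd g * g'"
    using g field_poly_irreducible_imp_prime[OF P] by (simp add: prime_elem_dvd_mult_iff)
  ultimately show ?thesis unfolding P_val_ge_iff[OF P] by blast
qed

lemma P_val_ge_mult:
  fixes P :: "'a::Fields.field poly"
  assumes P: "Factorial_Ring.irreducible P" and "Fin N \<le> P_val P x" "Fin M \<le> P_val P y"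
  shows "Fin (N + M) \<le> P_val P (x * y)"
proof -
  obtain f g f' g' where g: "\<not> P dvd g" "\<not> P dvd g'"
    and x: "x = to_fract P powi N * (to_fract f / to_fract g)"
    and y: "y = to_fract P powi M * (to_fract f' / to_fract g')"
    using assms by (auto simp: P_val_ge_iff[OF P])
  have "to_fract P \<noteq> 0" using P by auto
  hence "x * y = to_fract P powi (N + M) * (to_fract (f * f') / to_fract (g * g'))"
    unfolding x y by (simp add: to_fract_mult power_int_add)
  moreover have "\<not> P dvd g * g'"
    using g field_poly_irreducible_imp_prime[OF P] by (simp add: prime_elem_dvd_mult_iff)
  ultimately show ?thesis unfolding P_val_ge_iff[OF P] by blast
qed

lemma P_val_poly_ge_0:
  fixes P :: "'a::Fields.field poly"
  assumes P: "Factorial_Ring.irreducible P"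
  shows "Fin 0 \<le> P_val P (to_fract p)"
proof -
  have "\<not> P dvd 1" using P by (auto simp: Factorial_Ring.irreducible_def)
  thus ?thesis unfolding P_val_ge_iff[OF P] by (intro exI[of _ p] exI[of _ 1]) auto
qed

lemma P_null_ideal_iff:
  "h \<in> P_null_ideal P \<longleftrightarrow> (\<forall>N. \<forall>\<^sub>F i in sequentially. Fin N \<le> P_val P (h i))"
  by (simp add: P_null_ideal_def eventually_sequentially)

lemma zero_in_P_null_ideal: "(\<lambda>_. 0) \<in> P_null_ideal P"
  by (simp add: P_null_ideal_def P_val_def)

lemma P_null_ideal_add:
  assumes P: "Factorial_Ring.irreducible P" and "h \<in> P_null_ideal P" "k \<in> P_null_ideal P"
  shows "(\<lambda>i. h i + k i) \<in> P_null_ideal P"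
  unfolding P_null_ideal_iff
proof
  fix N
  have "\<forall>\<^sub>F i in sequentially. Fin N \<le> P_val P (h i)" "\<forall>\<^sub>F i in sequentially. Fin N \<le> P_val P (k i)"
    using assms by (auto simp: P_null_ideal_iff)
  thus "\<forall>\<^sub>F i in sequentially. Fin N \<le> P_val P (h i + k i)"
    by eventually_elim (rule P_val_ge_add[OF P])
qed

lemma P_null_ideal_mult:
  assumes P: "Factorial_Ring.irreducible P" and "h \<in> P_null_ideal P"
    and k: "\<forall>\<^sub>F i in sequentially. Fin 0 \<le> P_val P (k i)"
  shows "(\<lambda>i. h i * k i) \<in> P_null_ideal P"
  unfolding P_null_ideal_iff
proof
  fix N
  have "\<forall>\<^sub>F i in sequentially. Fin N \<le> P_val P (h i)" using assms by (auto simp: P_null_ideal_iff)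
  with k show "\<forall>\<^sub>F i in sequentially. Fin N \<le> P_val P (h i * k i)"
    by eventually_elim (use P_val_ge_mult[OF P, of N _ 0] in simp)
qed

lemma P_coset_iff:
  "w \<in> P_null_ideal P +>\<^bsub>P_cauchy_ring P\<^esub> u \<longleftrightarrow> (\<lambda>i. w i - u i) \<in> P_null_ideal P"
proof -
  have "w \<in> P_null_ideal P +>\<^bsub>P_cauchy_ring P\<^esub> u \<longleftrightarrow>
      (\<exists>h\<in>P_null_ideal P. w = (\<lambda>i. h i + u i))"
    by (auto simp: a_r_coset_def r_coset_def P_cauchy_ring_def)
  also have "\<dots> \<longleftrightarrow> (\<lambda>i. w i - u i) \<in> P_null_ideal P"
  proof
    assume "(\<lambda>i. w i - u i) \<in> P_null_ideal P"
    thus "\<exists>h\<in>P_null_ideal P. w = (\<lambda>i. h i + u i)" by (intro bexI[of _ "\<lambda>i. w i - u i"]) auto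
  qed auto
  finally show ?thesis .
qed

lemma P_completion_mult:
  "A \<otimes>\<^bsub>P_completion P\<^esub> B =
    (\<Union>a\<in>A. \<Union>b\<in>B. P_null_ideal P +>\<^bsub>P_cauchy_ring P\<^esub> (\<lambda>i. a i * b i))"
  by (simp add: P_completion_def FactRing_def rcoset_mult_def P_cauchy_ring_def)

lemma P_completion_one: "\<one>\<^bsub>P_completion P\<^esub> = to_completion P 1"
  by (simp add: P_completion_def FactRing_def to_completion_def) (simp add: P_cauchy_ring_def)

lemma P_completion_pow_0:
  "x [^]\<^bsub>P_completion P\<^esub> (0::nat) = \<one>\<^bsub>P_completion P\<^esub>"
  by (simp add: nat_pow_def)

lemma P_completion_pow_Suc:
  "x [^]\<^bsub>P_completion P\<^esub> Suc n = x [^]\<^bsub>P_completion P\<^esub> n \<otimes>\<^bsub>P_completion P\<^esub> x"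
  by (simp add: nat_pow_def)

text \<open>The ring axioms of the completion are not needed here: the null sequences contain 0, hence every
coset contains its representative.\<close>

lemma power_seq_mem_pow:
  assumes "u \<in> x"
  shows "(\<lambda>i. u i ^ n) \<in> x [^]\<^bsub>P_completion P\<^esub> n"
proof (induction n)
  case 0
  show ?case using zero_in_P_null_ideal[of P]
    by (simp add: P_completion_pow_0 P_completion_one to_completion_def P_coset_iff)
next
  case (Suc n)
  have "(\<lambda>i. u i ^ n * u i) \<in> P_null_ideal P +>\<^bsub>P_cauchy_ring P\<^esub> (\<lambda>i. u i ^ n * u i)"
    using zero_in_P_null_ideal[of P] by (simp add: P_coset_iff)
  moreover have "(\<lambda>i. u i ^ Suc n) = (\<lambda>i. u i ^ n * u i)" by (simp add: mult.commute)
  ultimately show ?case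
    unfolding P_completion_pow_Suc P_completion_mult
    by (intro UN_I[OF Suc] UN_I[OF assms]) simp
qed

text \<open>A polynomial that is an \<open>n\<close>-th power in the completion at \<open>P\<close> is an \<open>n\<close>-th power modulo \<open>P\<close>.
A term of a Cauchy sequence that represents the root is a fraction \<open>a / b\<close> whose \<open>n\<close>-th power
is congruent to \<open>\<alpha>\<close>; as \<open>\<alpha>\<close> is integral, \<open>P\<close> does not divide \<open>b\<close>.\<close>

theorem power_mod_prime_of_completion:
  fixes P \<alpha> :: "'a::Fields.field poly"
  assumes P: "Factorial_Ring.irreducible P" and n: "n > 0"
    and x: "x \<in> carrier (P_completion P)"
    and eq: "x [^]\<^bsub>P_completion P\<^esub> n = to_completion P (to_fract \<alpha>)"
  shows "\<exists>g. P dvd \<alpha> - g ^ n"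
proof -
  have pe: "prime_elem P" by (rule field_poly_irreducible_imp_prime[OF P])
  obtain u where u: "x = P_null_ideal P +>\<^bsub>P_cauchy_ring P\<^esub> u"
    using x by (auto simp: P_completion_def FactRing_def A_RCOSETS_def RCOSETS_def a_r_coset_def)
  hence "u \<in> x" using zero_in_P_null_ideal[of P] by (simp add: P_coset_iff)
  hence "(\<lambda>i. u i ^ n - to_fract \<alpha>) \<in> P_null_ideal P"
    using power_seq_mem_pow[of u x n P] eq by (simp add: to_completion_def P_coset_iff)
  then obtain i where "Fin 1 \<le> P_val P (u i ^ n - to_fract \<alpha>)"
    unfolding P_null_ideal_def by blast
  then obtain f g where g: "\<not> P dvd g" and fg: "u i ^ n - to_fract \<alpha> = to_fract P * (to_fract f / to_fract g)"
    unfolding P_val_ge_iff[OF P] by auto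
  obtain a b where ab: "b \<noteq> 0" "\<not> (P dvd a \<and> P dvd b)" "u i = to_fract a / to_fract b"
  proof (cases "u i = 0")
    case True
    have "\<not> P dvd 1" using P by (auto simp: Factorial_Ring.irreducible_def)
    with True that[of 1 0] show ?thesis by simp
  next
    case False
    obtain k a b where k: "a \<noteq> 0" "b \<noteq> 0" "\<not> P dvd a" "\<not> P dvd b"
      "u i = to_fract P powi k * (to_fract a / to_fract b)" using P_val_cases[OF P False] by blast
    have "P \<noteq> 0" using P by auto
    show ?thesis
    proof (cases "k \<ge> 0")
      case True
      hence "u i = to_fract (P ^ nat k * a) / to_fract b"
        using k(5) by (simp add: to_fract_mult to_fract_power power_int_def)
      with k that show ?thesis by blast
    next
      case neg: False
      hence "u i = to_fract a / to_fract (P ^ nat (- k) * b)"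
        using k(5) by (simp add: to_fract_mult to_fract_power power_int_def field_simps)
      with k \<open>P \<noteq> 0\<close> that[of "P ^ nat (- k) * b" a] show ?thesis by simp
    qed
  qed
  have nz: "to_fract b \<noteq> 0" "to_fract g \<noteq> 0" using ab g by auto
  have "to_fract (a ^ n * g) = to_fract ((\<alpha> * g + P * f) * b ^ n)"
    using fg nz unfolding ab(3)
    by (simp add: to_fract_mult to_fract_add to_fract_power power_divide field_simps)
  hence main: "a ^ n * g = (\<alpha> * g + P * f) * b ^ n" by (simp only: to_fract_eq_iff)
  have nb: "\<not> P dvd b"
  proof
    assume "P dvd b"
    hence "P dvd a ^ n * g" unfolding main using n by (intro dvd_mult) (simp add: dvd_power_iff_le dvd_trans dvd_power)
    hence "P dvd a" using pe g by (meson prime_elem_dvd_mult_iff prime_elem_dvd_power)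
    thus False using ab \<open>P dvd b\<close> by blast
  qed
  have "P dvd g * (a ^ n - \<alpha> * b ^ n)"
  proof
    show "g * (a ^ n - \<alpha> * b ^ n) = P * (f * b ^ n)" using main by (simp add: algebra_simps)
  qed
  hence D: "P dvd a ^ n - \<alpha> * b ^ n" using pe g by (simp add: prime_elem_dvd_mult_iff)
  obtain b' where b': "P dvd b * b' - 1" using exists_inverse_mod_irreducible[OF P nb] by blast
  have "P dvd (b * b') ^ n - 1 ^ n"
    unfolding power_diff_sumr2 by (rule dvd_mult2[OF b'])
  hence "P dvd \<alpha> * ((b * b') ^ n - 1) + (a ^ n - \<alpha> * b ^ n) * b' ^ n"
    using D by (intro dvd_add dvd_mult dvd_mult2) simp_all
  also have "\<alpha> * ((b * b') ^ n - 1) + (a ^ n - \<alpha> * b ^ n) * b' ^ n = - (\<alpha> - (a * b') ^ n)"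
    by (simp add: algebra_simps power_mult_distrib)
  finally show ?thesis by (auto simp only: dvd_minus_iff)
qed

lemma to_completion_mult:
  fixes P :: "'a::Fields.field poly"
  assumes P: "Factorial_Ring.irreducible P"
  shows "to_completion P (to_fract p) \<otimes>\<^bsub>P_completion P\<^esub> to_completion P (to_fract q) =
    to_completion P (to_fract (p * q))"
proof -
  define J where "J = P_null_ideal P"
  have J: "(\<lambda>i. a i * b i - to_fract (p * q)) \<in> J"
    if a: "(\<lambda>i. a i - to_fract p) \<in> J" and b: "(\<lambda>i. b i - to_fract q) \<in> J" for a b
  proof -
    have "\<forall>\<^sub>F i in sequentially. Fin 0 \<le> P_val P (b i - to_fract q)"
      using b by (simp add: J_def P_null_ideal_iff)
    hence "\<forall>\<^sub>F i in sequentially. Fin 0 \<le> P_val P (b i)"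
      by eventually_elim (use P_val_ge_add[OF P _ P_val_poly_ge_0[OF P, of q]] in force)
    from P_null_ideal_mult[OF P _ this] a
    have "(\<lambda>i. (a i - to_fract p) * b i) \<in> J" by (simp add: J_def)
    moreover have "(\<lambda>i. (b i - to_fract q) * to_fract p) \<in> J"
      unfolding J_def by (rule P_null_ideal_mult[OF P])
         (use b P_val_poly_ge_0[OF P] in \<open>auto simp: J_def\<close>)
    ultimately have "(\<lambda>i. (a i - to_fract p) * b i + (b i - to_fract q) * to_fract p) \<in> J"
      unfolding J_def by (rule P_null_ideal_add[OF P])
    thus ?thesis by (simp add: to_fract_mult algebra_simps)
  qed
  show ?thesis
  proof (rule Set.set_eqI)
    fix w
    have "w \<in> to_completion P (to_fract p) \<otimes>\<^bsub>P_completion P\<^esub> to_completion P (to_fract q) \<longleftrightarrow>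
        (\<exists>a. (\<lambda>i. a i - to_fract p) \<in> J \<and> (\<exists>b. (\<lambda>i. b i - to_fract q) \<in> J \<and>
           (\<lambda>i. w i - a i * b i) \<in> J))"
      unfolding P_completion_mult to_completion_def UN_iff Bex_def P_coset_iff J_def by (rule refl)
    also have "\<dots> \<longleftrightarrow> (\<lambda>i. w i - to_fract (p * q)) \<in> J"
    proof (intro iffI; (elim exE conjE)?)
      fix a b assume ab: "(\<lambda>i. a i - to_fract p) \<in> J" "(\<lambda>i. b i - to_fract q) \<in> J"
        "(\<lambda>i. w i - a i * b i) \<in> J"
      have "(\<lambda>i. (w i - a i * b i) + (a i * b i - to_fract (p * q))) \<in> J"
        using P_null_ideal_add[OF P] ab(3) J[OF ab(1,2)] unfolding J_def by blast
      thus "(\<lambda>i. w i - to_fract (p * q)) \<in> J" by simp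
    next
      assume "(\<lambda>i. w i - to_fract (p * q)) \<in> J"
      thus "\<exists>a. (\<lambda>i. a i - to_fract p) \<in> J \<and> (\<exists>b. (\<lambda>i. b i - to_fract q) \<in> J \<and>
           (\<lambda>i. w i - a i * b i) \<in> J)"
        using zero_in_P_null_ideal[of P]
        by (intro exI[of _ "\<lambda>_. to_fract p"] exI[of _ "\<lambda>_. to_fract q"] conjI)
           (simp_all add: J_def to_fract_mult)
    qed
    finally show "w \<in> to_completion P (to_fract p) \<otimes>\<^bsub>P_completion P\<^esub> to_completion P (to_fract q) \<longleftrightarrow>
        w \<in> to_completion P (to_fract (p * q))"
      unfolding to_completion_def P_coset_iff J_def .
  qed
qed

lemma to_completion_power:
  fixes P :: "'a::Fields.field poly"
  assumes P: "Factorial_Ring.irreducible P"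
  shows "to_completion P (to_fract p) [^]\<^bsub>P_completion P\<^esub> n = to_completion P (to_fract (p ^ n))"
proof (induction n)
  case (Suc n)
  thus ?case by (simp add: P_completion_pow_Suc to_completion_mult[OF P] mult.commute)
qed (simp add: P_completion_pow_0 P_completion_one)

lemma to_completion_in_carrier: "to_completion P x \<in> carrier (P_completion P)"
proof -
  have "(\<lambda>_. x) \<in> carrier (P_cauchy_ring P)" by (simp add: P_cauchy_ring_def P_val_def)
  thus ?thesis
    by (auto simp: P_completion_def FactRing_def A_RCOSETS_def RCOSETS_def a_r_coset_def
        to_completion_def)
qed

section \<open>The local-global principle\<close>

lemma exists_monic_prime_root:
  fixes \<theta> :: "'a::Fields.field alg_closure"
  shows "\<exists>P. monic_prime P \<and> poly (lift_poly P) \<theta> = 0"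
proof -
  define Q where "Q p \<longleftrightarrow> p \<noteq> 0 \<and> poly (lift_poly p) \<theta> = 0" for p
  obtain p0 where "Q p0" using alg_closure_algebraic[of \<theta>] by (auto simp: Q_def lift_poly_def)
  then obtain p where p: "Q p" and min: "\<And>q. Q q \<Longrightarrow> Polynomial.degree p \<le> Polynomial.degree q"
    using ex_has_least_nat[of Q p0 Polynomial.degree] by auto
  define P where "P = smult (inverse (lead_coeff p)) p"
  have P: "Q P" "lead_coeff P = 1" "Polynomial.degree P = Polynomial.degree p"
    using p by (auto simp: Q_def P_def lift_poly_smult)
  have "Factorial_Ring.irreducible P"
  proof (rule Factorial_Ring.irreducibleI)
    show "P \<noteq> 0" using P by (auto simp: Q_def)
    show "\<not> is_unit P"
    proof
      assume "is_unit P"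
      hence "Polynomial.degree P = 0" using \<open>P \<noteq> 0\<close> is_unit_iff_degree by blast
      hence "P = 1" using P(2) monic_degree_0 by blast
      thus False using P(1) by (simp add: Q_def lift_poly_1)
    qed
    fix a b assume ab: "P = a * b"
    hence nz: "a \<noteq> 0" "b \<noteq> 0" using \<open>P \<noteq> 0\<close> by auto
    have deg: "Polynomial.degree P = Polynomial.degree a + Polynomial.degree b"
      unfolding ab using nz by (rule degree_mult_eq)
    have "Q a \<or> Q b" using P(1) nz by (auto simp: Q_def ab lift_poly_mult)
    hence "Polynomial.degree a = 0 \<or> Polynomial.degree b = 0" using min deg P(3) by fastforce
    thus "is_unit a \<or> is_unit b" using nz by (simp add: is_unit_iff_degree)
  qed
  thus ?thesis using P by (intro exI[of _ P]) (simp add: monic_prime_def Q_def)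
qed

text \<open>If \<open>\<alpha>\<close> is an \<open>n\<close>-th power modulo almost all monic primes, then it is an \<open>n\<close>-th power. The roots
of \<open>M\<close> are the points that belong to the exceptional primes, and \<open>R\<close> collects what the finite
extension \<open>E\<close> has to contain.\<close>

lemma poly_power_of_local_powers:
  fixes D :: "'s filter" and K :: "'s \<Rightarrow> 'b ring" and \<alpha> :: "'a::Fields.field poly"
  assumes UF: "ultra_finite_field D K TYPE('a)"
    and \<alpha>: "\<alpha> \<noteq> 0" and n: "n > 0" and nF: "of_nat n \<noteq> (0 :: 'a)"
    and fin: "finite S"
    and loc: "\<And>P. monic_prime P \<Longrightarrow> P \<notin> S \<Longrightarrow> \<exists>g. P dvd \<alpha> - g ^ n"
  shows "\<exists>x. x ^ n = \<alpha>"
proof -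
  obtain \<Phi> :: "('s \<Rightarrow> 'b) \<Rightarrow> 'a" where "ultraproduct_coords D K \<Phi>"
    using ultra_finite_field_coords[OF UF] by blast
  then interpret ultraproduct_coords D K \<Phi> .
  define F where "F = range (to_ac :: 'a \<Rightarrow> _)"
  define A where "A = lift_poly \<alpha>"
  \<comment> \<open>The exceptional set may contain 0, which would make the product vanish.\<close>
  define M where "M = lift_poly (\<Prod>P\<in>S - {0}. P)"
  have nL: "of_nat n \<noteq> (0 :: 'a alg_closure)"
    using nF by (metis to_ac_eq_0_iff to_ac_of_nat)
  have A0: "A \<noteq> 0" using \<alpha> by (simp add: A_def)
  have M0: "M \<noteq> 0" using fin by (simp add: M_def)
  have F: "polys_over F = range lift_poly" unfolding F_def by (rule polys_over_range_to_ac)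
  have local: "\<exists>P\<in>polys_over F. \<exists>g\<in>polys_over F. poly P \<theta> = 0 \<and>
      (\<forall>z. poly P z = 0 \<longrightarrow> poly A z = poly g z ^ n)" if \<theta>: "poly M \<theta> \<noteq> 0" for \<theta>
  proof -
    obtain P :: "'a poly" where P: "monic_prime P" "poly (lift_poly P) \<theta> = 0"
      using exists_monic_prime_root by blast
    have "P \<notin> S"
    proof
      assume "P \<in> S"
      moreover have "P \<noteq> 0" using P(1) by (auto simp: monic_prime_def)
      ultimately have "P dvd (\<Prod>P\<in>S - {0}. P)" using fin by (intro dvd_prodI) auto
      then obtain q where "(\<Prod>P\<in>S - {0}. P) = P * q" by (elim dvdE)
      hence "poly M \<theta> = 0" using P(2) by (simp add: M_def lift_poly_mult)
      thus False using \<theta> by simp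
    qed
    then obtain g h where "\<alpha> - g ^ n = P * h" using loc[OF P(1)] unfolding dvd_def by blast
    hence "A - lift_poly g ^ n = lift_poly P * lift_poly h"
      unfolding A_def by (metis lift_poly_diff lift_poly_mult lift_poly_power)
    hence "poly A z - poly (lift_poly g) z ^ n = poly (lift_poly P) z * poly (lift_poly h) z" for z
      by (metis poly_diff poly_mult poly_power)
    hence "poly A z = poly (lift_poly g) z ^ n" if "poly (lift_poly P) z = 0" for z
      using that by (metis mult_zero_left right_minus_eq)
    thus ?thesis using P(2) F by blast
  qed
  have pow: "\<exists>y\<in>E. root_prod f A = y ^ n"
    if "alg_closed_subfield_set E" "F \<subseteq> E" "f \<in> polys_over E" "lead_coeff f = 1"
      "\<And>z. poly f z = 0 \<Longrightarrow> poly M z \<noteq> 0" for E f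
  proof -
    interpret alg_closed_subfield_set E by fact
    show ?thesis
      using that(3-5) local polys_over_mono[OF that(2)]
      by (intro root_prod_is_power) (blast dest: subsetD)+
  qed
  define R where "R = {z. poly (A * M) z = 0} \<union> {z. z ^ n = (1 :: 'a alg_closure)}"
  have "{z. z ^ n = (1 :: 'a alg_closure)} = {z. poly (monom 1 n - 1) z = 0}"
    by (simp add: poly_monom)
  moreover have "monom 1 n - 1 \<noteq> (0 :: 'a alg_closure poly)"
  proof
    assume "monom 1 n - 1 = (0 :: 'a alg_closure poly)"
    hence "Polynomial.coeff (monom 1 n - 1 :: 'a alg_closure poly) n = 0" by simp
    thus False using n by simp
  qed
  ultimately have "finite R"
    unfolding R_def using A0 M0 by (simp add: poly_roots_finite del: poly_diff poly_mult)
  then obtain B where B: "spans_subalgebra B" "R \<subseteq> ac.span B"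
    using exists_spanning_set_subalgebra by blast
  define E where "E = ac.span B"
  have sE: "alg_closed_subfield_set E"
    unfolding E_def alg_closed_subfield_set_def by (rule subfield_set_span[OF B(1)])
  then interpret E: alg_closed_subfield_set E .
  have FE: "F \<subseteq> E" unfolding F_def E_def by (rule range_to_ac_subset_span[OF B(1)])
  have AF: "A \<in> polys_over F" by (simp add: F A_def)
  have ord: "n dvd Polynomial.order \<beta> A" if \<beta>: "poly A \<beta> = 0" for \<beta>
  proof (rule E.power_class_exponent_dvd[OF n nL])
    show "z \<in> E" if "z ^ n = 1" for z using that B(2) by (auto simp: R_def E_def)
    show "inj_on (\<lambda>z. z ^ m) E" if "\<forall>c\<in>E. \<exists>z\<in>E. c = z ^ m" for m
      using power_surj_imp_inj[OF B(1)] that by (simp add: E_def)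
    show "\<exists>z\<in>E. c ^ Polynomial.order \<beta> A = z ^ n" if "c \<in> E" "c \<noteq> 0" for c
    proof (rule E.pow_order_is_power[OF _ A0 M0 _ _ \<beta> that n])
      show "A \<in> polys_over E" using AF polys_over_mono[OF FE] by blast
      show "z \<in> E" if "poly (A * M) z = 0" for z using that B(2) by (auto simp: R_def E_def)
    qed (rule pow[OF sE FE])
  qed
  have sF: "alg_closed_subfield_set F"
    unfolding F_def alg_closed_subfield_set_def by (rule subfield_set_range_to_ac)
  then interpret F: alg_closed_subfield_set F .
  obtain b' where b': "lead_coeff b' = 1" "A = smult (lead_coeff A) (b' ^ n)"
    using exists_power_of_order_dvd[OF A0 ord] by blast
  define c where "c = lead_coeff A"
  have c: "c \<noteq> 0" "c \<in> F" using A0 AF by (auto simp: c_def polys_overD)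
  have "b' ^ n = smult (inverse c) A" using b'(2) c(1) by (simp flip: c_def)
  hence "b' ^ n \<in> polys_over F" using F.polys_over_smult F.inverse_mem c AF by metis
  hence b'F: "b' \<in> polys_over F" using F.monic_power_root_mem[OF b'(1) nL] by blast
  then obtain b where b: "b' = lift_poly b" using F by blast
  have "\<exists>y\<in>F. c = y ^ n"
  proof (rule F.leading_coeff_is_power[OF b'F b'(1) _ M0 c n])
    show "M \<in> polys_over F" by (simp add: F M_def)
    fix f assume "f \<in> polys_over F" "lead_coeff f = 1" "\<And>z. poly f z = 0 \<Longrightarrow> poly M z \<noteq> 0"
    from pow[OF sF order_refl this] show "\<exists>y\<in>F. root_prod f (smult c (b' ^ n)) = y ^ n"
      using b'(2) by (simp add: c_def)
  qed
  then obtain y where y: "c = to_ac y ^ n" by (auto simp: F_def)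
  have "lift_poly (smult y b ^ n) = A"
    using b'(2) y by (simp add: lift_poly_smult lift_poly_power smult_power b flip: c_def)
  thus ?thesis unfolding A_def by (metis lift_poly_eq_iff)
qed

theorem theorem1p4:
  fixes D :: "'s filter" and K :: "'s \<Rightarrow> 'b ring"
    and \<alpha> :: "'a::Fields.field poly" and n :: nat
  assumes "ultra_finite_field D K TYPE('a)"
    and "degree \<alpha> > 0"
    and "n > 0"
    and "CHAR('a) = 0 \<or> \<not> CHAR('a) dvd n"
  shows "(\<exists>x :: 'a poly. x ^ n = \<alpha>) \<longleftrightarrow>
         finite {P :: 'a poly. monic_prime P \<and>
           \<not> (\<exists>x \<in> carrier (P_completion P).
                 x [^]\<^bsub>P_completion P\<^esub> n = to_completion P (to_fract \<alpha>))}"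
proof
  assume "\<exists>x. x ^ n = \<alpha>"
  then obtain x where x: "x ^ n = \<alpha>" ..
  have "\<exists>y\<in>carrier (P_completion P). y [^]\<^bsub>P_completion P\<^esub> n = to_completion P (to_fract \<alpha>)"
    if "monic_prime P" for P
    using to_completion_in_carrier to_completion_power[of P x n] that
    by (auto simp: monic_prime_def x)
  thus "finite {P :: 'a poly. monic_prime P \<and>
           \<not> (\<exists>x \<in> carrier (P_completion P).
                 x [^]\<^bsub>P_completion P\<^esub> n = to_completion P (to_fract \<alpha>))}"
    by (simp add: Collect_empty_eq cong: conj_cong)
next
  assume fin: "finite {P :: 'a poly. monic_prime P \<and>
           \<not> (\<exists>x \<in> carrier (P_completion P).
                 x [^]\<^bsub>P_completion P\<^esub> n = to_completion P (to_fract \<alpha>))}"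
  have "of_nat n \<noteq> (0 :: 'a)" using assms(3,4) by (auto simp: of_nat_eq_0_iff_char_dvd)
  moreover have "\<alpha> \<noteq> 0" using assms(2) by auto
  ultimately show "\<exists>x. x ^ n = \<alpha>"
  proof (intro poly_power_of_local_powers[OF assms(1) _ assms(3) _ fin])
    fix P assume "monic_prime P" and "P \<notin> {P :: 'a poly. monic_prime P \<and>
           \<not> (\<exists>x \<in> carrier (P_completion P).
                 x [^]\<^bsub>P_completion P\<^esub> n = to_completion P (to_fract \<alpha>))}"
    thus "\<exists>g. P dvd \<alpha> - g ^ n"
      using power_mod_prime_of_completion[OF _ assms(3), of P _ \<alpha>] by (auto simp: monic_prime_def)
  qed
qed

end
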